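(* Let $\mathcal E$ be a regular Dirichlet form on $L^2(X,m)$ which is local (i.e. its jump measure satisfies $J\equiv 0$), and assume that $$\varrho(x,y):=\sup\{u(x)-u(y): u\in\mathcal D_{loc}\cap C(X),\ \mu^{(c)}(u)\le m\}$$ is continuous. Then $\varrho$ is an intrinsic metric for $\mathcal E$, and any other intrinsic metric for $\mathcal E$ is pointwise smaller than or equal to $\varrho$.
   Context: Setting. $X$ is a locally compact separable metric space, $m$ a positive Radon measure on $X$ with $\operatorname{supp} m=X$; all functions are real valued; $C(X)$ denotes the continuous functions and $C_c(X)$ the continuous compactly supported functions. $\mathcal E:\mathcal D\times\mathcal D\to\mathbb R$, with $\mathcal D$ dense in $L^2(X,m)$, is a regular (symmetric) Dirichlet form: it is closed, non-negative, $\mathcal E(T\circ u,T\circ u)\le\mathcal E(u,u)$ for all normal contractions $T$, and $\mathcal D\cap C_c(X)$ is dense in $\mathcal D$ with respect to $\sqrt{\mathcal E_1}$, where $\mathcal E_1(u,u)=\mathcal E(u,u)+\|u\|_{L^2}^2$, and dense in $C_c(X)$ with respect to $\|\cdot\|_\infty$. For bilinear expressions $q$ write $q(u):=q(u,u)$. $\tilde u$ denotes a quasi-continuous representative of $u$ (with respect to the capacity of $\mathcal E$); it exists for $u\in\mathcal D$ and $u\in\mathcal D_{loc}$ (below). Beurling–Deny formula: with $d=\{(x,x):x\in X\}$, there are a non-negative Radon measure $k$ on $X$, a non-negative symmetric Radon measure $J$ on $X\times X\setminus d$, and a positive semidefinite bilinear form $\mu^{(c)}$ on $\mathcal D$ with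 values in the signed Radon measures on $X$, strongly local (i.e. $\mu^{(c)}(u,v)=0$ if $u$ is constant on $\operatorname{supp}v$), such that for $u\in\mathcal D$ $$\mathcal E(u)=\int_{X\times X\setminus d}(\tilde u(x)-\tilde u(y))^2\,J(dx,dy)+\int_X d\mu^{(c)}(u)+\int_X\tilde u^2\,dk.$$ Local spaces: $\mathcal D_{loc}$ is the set of $u\in L^2_{loc}$ such that for every open relatively compact $G\subset X$ there is $v\in\mathcal D$ with $u=v$ on $G$. $\mathcal D_{loc}^*$ is the set of $u\in\mathcal D_{loc}$ with $\int_{K\times X\setminus d}(\tilde u(x)-\tilde u(y))^2J(dx,dy)<\infty$ for all compact $K\subset X$ (so $\mathcal D_{loc}^*=\mathcal D_{loc}$ if $J\equiv0$). $\mu^{(c)}$ is extended to $\mathcal D_{loc}$ by locality ($\mu^{(c)}(u)=\mu^{(c)}(v)$ on $G$ if $u=v$ on the open relatively compact set $G$). For $u\in\mathcal D_{loc}^*$ put $\mu^{(b)}(u)(E)=\int_{E\times X\setminus d}(\tilde u(x)-\tilde u(y))^2J(dx,dy)$ for measurable $E\subset X$ (which is $0$ if $J\equiv 0$). A pseudo-metric is a map $\varrho:X\times X\to[0,\infty]$ with $\varrho(x,x)=0$, symmetric, satisfying the triangle inequality; $\varrho_A(x):=\inf_{y\in A}\varrho(x,y)$ for $A\subset X$. A pseudo-metric $\varrho$ is an intrinsic metric for $\mathcal E$ if there are Radon measures $m_b,m_c$ with $m_b+m_c\le m$ such that for all $A\subset X$ and all $T>0$: $\varrho_A\wedge T\in\mathcal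 D_{loc}^*\cap C(X)$, $\mu^{(b)}(\varrho_A\wedge T)\le m_b$ and $\mu^{(c)}(\varrho_A\wedge T)\le m_c$. Continuity is with respect to the original topology of $X$. *)

theory Defs
  imports "HOL-Analysis.Analysis"
begin

section \<open>Measures and function spaces\<close>

text \<open>
  The space \<open>X\<close> is a type of class \<open>{metric_space, second_countable_topology}\<close>; for metric
  spaces second countability is the same as separability.  Local compactness is a hypothesis of
  the theorem.

  Elements of \<open>L\<^sup>2\<close> are represented by Borel functions, and spaces of classes modulo
  almost everywhere equality by sets of Borel functions that are closed under almost everywhere
  equality.  So a continuous function belongs to such a set iff its class does.
\<close>

definition radon_measure_on :: "'a::topological_space set \<Rightarrow> 'a measure \<Rightarrow> bool" where
  "radon_measure_on S M \<longleftrightarrow>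
     sets M = sets (restrict_space borel S) \<and>
     (\<forall>K. compact K \<and> K \<subseteq> S \<longrightarrow> emeasure M K < \<infinity>) \<and>
     (\<forall>B\<in>sets M. emeasure M B = (SUP K\<in>{K. compact K \<and> K \<subseteq> B}. emeasure M K))"

abbreviation radon_measure :: "'a::topological_space measure \<Rightarrow> bool" where
  "radon_measure \<equiv> radon_measure_on UNIV"

lemma radon_measure_sets: "radon_measure M \<Longrightarrow> sets M = sets borel"
  by (simp add: radon_measure_on_def sets_restrict_space)

definition full_support :: "'a::topological_space measure \<Rightarrow> bool" where
  "full_support M \<longleftrightarrow> (\<forall>U. open U \<and> U \<noteq> {} \<longrightarrow> emeasure M U > 0)"

text \<open>
  Finite signed Radon measures, as real valued set functions on the Borel sets.  Finiteness is
  no restriction for the values of \<open>\<mu>\<^sup>(\<^sup>c\<^sup>)\<close> below: on the diagonal they have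
  finite total mass because \<open>\<E>(u)\<close> is finite, and polarization covers the rest.
\<close>

definition signed_radon_measure :: "('a::topological_space set \<Rightarrow> real) \<Rightarrow> bool" where
  "signed_radon_measure \<nu> \<longleftrightarrow>
     (\<exists>M N. radon_measure M \<and> radon_measure N \<and> finite_measure M \<and> finite_measure N \<and>
        (\<forall>B\<in>sets borel. \<nu> B = measure M B - measure N B))"

definition L2_space :: "'a measure \<Rightarrow> ('a \<Rightarrow> real) set" where
  "L2_space m = {u. u \<in> borel_measurable m \<and> integrable m (\<lambda>x. (u x)\<^sup>2)}"

definition L2_loc :: "'a::topological_space measure \<Rightarrow> ('a \<Rightarrow> real) set" where
  "L2_loc m = {u. u \<in> borel_measurable m \<and>
                  (\<forall>K. compact K \<longrightarrow> set_integrable m K (\<lambda>x. (u x)\<^sup>2))}"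

definition C_space :: "('a::topological_space \<Rightarrow> real) set" where
  "C_space = {u. continuous_on UNIV u}"

definition Cc_space :: "('a::topological_space \<Rightarrow> real) set" where
  "Cc_space = {u. continuous_on UNIV u \<and> compact (closure {x. u x \<noteq> 0})}"

definition eq_ae_on :: "'a measure \<Rightarrow> 'a set \<Rightarrow> ('a \<Rightarrow> real) \<Rightarrow> ('a \<Rightarrow> real) \<Rightarrow> bool" where
  "eq_ae_on m G u v \<longleftrightarrow> (AE x in m. x \<in> G \<longrightarrow> u x = v x)"

text \<open>The support of a class: the complement of the largest open set on which it vanishes.\<close>

definition ae_support :: "'a::topological_space measure \<Rightarrow> ('a \<Rightarrow> real) \<Rightarrow> 'a set" where
  "ae_support m u = - \<Union>{U. open U \<and> eq_ae_on m U u (\<lambda>_. 0)}"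

definition relatively_compact_open :: "'a::topological_space set \<Rightarrow> bool" where
  "relatively_compact_open G \<longleftrightarrow> open G \<and> compact (closure G)"


section \<open>Regular Dirichlet forms\<close>

definition normal_contraction :: "(real \<Rightarrow> real) \<Rightarrow> bool" where
  "normal_contraction T \<longleftrightarrow> T 0 = 0 \<and> (\<forall>s t. \<bar>T s - T t\<bar> \<le> \<bar>s - t\<bar>)"

definition form_E1 ::
  "'a measure \<Rightarrow> (('a \<Rightarrow> real) \<Rightarrow> ('a \<Rightarrow> real) \<Rightarrow> real) \<Rightarrow> ('a \<Rightarrow> real) \<Rightarrow> real" where
  "form_E1 m \<E> u = \<E> u u + (\<integral>x. (u x)\<^sup>2 \<partial>m)"

definition symmetric_bilinear_on ::
  "('a \<Rightarrow> real) set \<Rightarrow> (('a \<Rightarrow> real) \<Rightarrow> ('a \<Rightarrow> real) \<Rightarrow> real) \<Rightarrow> bool" where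
  "symmetric_bilinear_on D q \<longleftrightarrow>
     (\<forall>u\<in>D. \<forall>v\<in>D. q u v = q v u) \<and>
     (\<forall>u\<in>D. \<forall>v\<in>D. \<forall>w\<in>D. \<forall>a b. q (\<lambda>x. a * u x + b * v x) w = a * q u w + b * q v w)"

definition dirichlet_form ::
  "'a::topological_space measure \<Rightarrow> ('a \<Rightarrow> real) set \<Rightarrow>
   (('a \<Rightarrow> real) \<Rightarrow> ('a \<Rightarrow> real) \<Rightarrow> real) \<Rightarrow> bool" where
  "dirichlet_form m D \<E> \<longleftrightarrow>
     D \<subseteq> L2_space m \<and>
     \<comment> \<open>\<open>D\<close> and \<open>\<E>\<close> only depend on classes\<close>
     (\<forall>u\<in>D. \<forall>v\<in>borel_measurable m. (AE x in m. u x = v x) \<longrightarrow>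
        v \<in> D \<and> (\<forall>w\<in>D. \<E> u w = \<E> v w)) \<and>
     \<comment> \<open>\<open>D\<close> is a dense subspace of \<open>L\<^sup>2\<close>\<close>
     (\<lambda>_. 0) \<in> D \<and> (\<forall>u\<in>D. \<forall>v\<in>D. \<forall>a b. (\<lambda>x. a * u x + b * v x) \<in> D) \<and>
     (\<forall>f\<in>L2_space m. \<forall>\<epsilon>>0. \<exists>u\<in>D. (\<integral>x. (f x - u x)\<^sup>2 \<partial>m) < \<epsilon>) \<and>
     symmetric_bilinear_on D \<E> \<and>
     (\<forall>u\<in>D. \<E> u u \<ge> 0) \<and>
     \<comment> \<open>closedness: \<open>D\<close> is complete with respect to the norm given by \<open>\<E>\<^sub>1\<close>\<close>
     (\<forall>f. (\<forall>n. f n \<in> D) \<and>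
          (\<forall>\<epsilon>>0. \<exists>N. \<forall>i\<ge>N. \<forall>j\<ge>N. form_E1 m \<E> (\<lambda>x. f i x - f j x) < \<epsilon>) \<longrightarrow>
          (\<exists>u\<in>D. (\<lambda>n::nat. form_E1 m \<E> (\<lambda>x. f n x - u x)) \<longlonglongrightarrow> 0)) \<and>
     (\<forall>T. normal_contraction T \<longrightarrow>
        (\<forall>u\<in>D. T \<circ> u \<in> D \<and> \<E> (T \<circ> u) (T \<circ> u) \<le> \<E> u u))"

definition regular_dirichlet_form ::
  "'a::topological_space measure \<Rightarrow> ('a \<Rightarrow> real) set \<Rightarrow>
   (('a \<Rightarrow> real) \<Rightarrow> ('a \<Rightarrow> real) \<Rightarrow> real) \<Rightarrow> bool" where
  "regular_dirichlet_form m D \<E> \<longleftrightarrow>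
     dirichlet_form m D \<E> \<and>
     (\<forall>u\<in>D. \<forall>\<epsilon>>0. \<exists>v\<in>D \<inter> Cc_space. form_E1 m \<E> (\<lambda>x. u x - v x) < \<epsilon>) \<and>
     (\<forall>f\<in>Cc_space. \<forall>\<epsilon>>0. \<exists>v\<in>D \<inter> Cc_space. \<forall>x. \<bar>f x - v x\<bar> < \<epsilon>)"


section \<open>Capacity and quasi-continuity\<close>

text \<open>The infimum of the empty set is \<open>\<infinity>\<close> in \<open>ennreal\<close>, as is customary for capacities.\<close>

definition capacity ::
  "'a::topological_space measure \<Rightarrow> ('a \<Rightarrow> real) set \<Rightarrow>
   (('a \<Rightarrow> real) \<Rightarrow> ('a \<Rightarrow> real) \<Rightarrow> real) \<Rightarrow> 'a set \<Rightarrow> ennreal" where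
  "capacity m D \<E> A =
     (INF u\<in>{u\<in>D. \<exists>U. open U \<and> A \<subseteq> U \<and> (AE x in m. x \<in> U \<longrightarrow> u x \<ge> 1)}.
        ennreal (form_E1 m \<E> u))"

definition quasi_continuous ::
  "'a::topological_space measure \<Rightarrow> ('a \<Rightarrow> real) set \<Rightarrow>
   (('a \<Rightarrow> real) \<Rightarrow> ('a \<Rightarrow> real) \<Rightarrow> real) \<Rightarrow> ('a \<Rightarrow> real) \<Rightarrow> bool" where
  "quasi_continuous m D \<E> u \<longleftrightarrow>
     (\<forall>\<epsilon>>0. \<exists>U. open U \<and> capacity m D \<E> U < ennreal \<epsilon> \<and> continuous_on (- U) u)"

text \<open>
  A quasi-continuous function can be changed on a set of capacity zero so that it becomes Borel
  measurable; only such representatives are considered, so that they can be integrated.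
\<close>

definition quasi_continuous_rep ::
  "'a::topological_space measure \<Rightarrow> ('a \<Rightarrow> real) set \<Rightarrow>
   (('a \<Rightarrow> real) \<Rightarrow> ('a \<Rightarrow> real) \<Rightarrow> real) \<Rightarrow> ('a \<Rightarrow> real) \<Rightarrow> ('a \<Rightarrow> real) \<Rightarrow> bool" where
  "quasi_continuous_rep m D \<E> u w \<longleftrightarrow>
     w \<in> borel_measurable borel \<and> quasi_continuous m D \<E> w \<and> (AE x in m. w x = u x)"

definition qc_rep ::
  "'a::topological_space measure \<Rightarrow> ('a \<Rightarrow> real) set \<Rightarrow>
   (('a \<Rightarrow> real) \<Rightarrow> ('a \<Rightarrow> real) \<Rightarrow> real) \<Rightarrow> ('a \<Rightarrow> real) \<Rightarrow> ('a \<Rightarrow> real)" where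
  "qc_rep m D \<E> u = (SOME w. quasi_continuous_rep m D \<E> u w)"


section \<open>Beurling--Deny decomposition\<close>

definition off_diagonal :: "('a \<times> 'a) set" where
  "off_diagonal = {(x, y). x \<noteq> y}"

text \<open>
  \<open>\<Gamma> u v B\<close> stands for \<open>\<mu>\<^sup>(\<^sup>c\<^sup>)(u,v)(B)\<close>.  Besides strong locality we
  list the locality property that makes the extension of \<open>\<mu>\<^sup>(\<^sup>c\<^sup>)\<close> to the local
  space well defined.  It is needed to pin down \<open>\<mu>\<^sup>(\<^sup>c\<^sup>)\<close>: for
  \<open>\<E>(u) = \<integral> u'\<^sup>2 dx\<close> on the real line, the translates
  \<open>B \<mapsto> \<integral>\<^bsub>B+1\<^esub> u'v' dx\<close> satisfy all the other conditions.
\<close>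

definition strongly_local ::
  "'a::topological_space measure \<Rightarrow> ('a \<Rightarrow> real) set \<Rightarrow>
   (('a \<Rightarrow> real) \<Rightarrow> ('a \<Rightarrow> real) \<Rightarrow> 'a set \<Rightarrow> real) \<Rightarrow> bool" where
  "strongly_local m D \<Gamma> \<longleftrightarrow>
     (\<forall>u\<in>D. \<forall>v\<in>D. (\<exists>c. eq_ae_on m (ae_support m v) u (\<lambda>_. c)) \<longrightarrow>
        (\<forall>B\<in>sets borel. \<Gamma> u v B = 0)) \<and>
     (\<forall>u\<in>D. \<forall>v\<in>D. \<forall>G. relatively_compact_open G \<and> eq_ae_on m G u v \<longrightarrow>
        (\<forall>B\<in>sets borel. B \<subseteq> G \<longrightarrow> \<Gamma> u u B = \<Gamma> v v B))"

text \<open>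
  The formula is required for every quasi-continuous representative \<open>w\<close> of \<open>u\<close>; in
  particular \<open>J\<close> and \<open>k\<close> do not see sets of capacity zero.
\<close>

definition beurling_deny ::
  "'a::topological_space measure \<Rightarrow> ('a \<Rightarrow> real) set \<Rightarrow>
   (('a \<Rightarrow> real) \<Rightarrow> ('a \<Rightarrow> real) \<Rightarrow> real) \<Rightarrow> ('a \<times> 'a) measure \<Rightarrow>
   (('a \<Rightarrow> real) \<Rightarrow> ('a \<Rightarrow> real) \<Rightarrow> 'a set \<Rightarrow> real) \<Rightarrow> 'a measure \<Rightarrow> bool" where
  "beurling_deny m D \<E> J \<Gamma> k \<longleftrightarrow>
     radon_measure k \<and>
     radon_measure_on off_diagonal J \<and>
     (\<forall>B\<in>sets J. emeasure J (prod.swap ` B) = emeasure J B) \<and>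
     (\<forall>u\<in>D. \<forall>v\<in>D. signed_radon_measure (\<Gamma> u v)) \<and>
     (\<forall>B\<in>sets borel. symmetric_bilinear_on D (\<lambda>u v. \<Gamma> u v B) \<and> (\<forall>u\<in>D. \<Gamma> u u B \<ge> 0)) \<and>
     strongly_local m D \<Gamma> \<and>
     (\<forall>u\<in>D. \<forall>w. quasi_continuous_rep m D \<E> u w \<longrightarrow>
        ennreal (\<E> u u) =
          (\<integral>\<^sup>+ (x, y). ennreal ((w x - w y)\<^sup>2) \<partial>J)
          + ennreal (\<Gamma> u u UNIV)
          + (\<integral>\<^sup>+ x. ennreal ((w x)\<^sup>2) \<partial>k))"


section \<open>Local spaces and energy measures\<close>

definition D_loc :: "'a::topological_space measure \<Rightarrow> ('a \<Rightarrow> real) set \<Rightarrow> ('a \<Rightarrow> real) set" where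
  "D_loc m D = {u \<in> L2_loc m. \<forall>G. relatively_compact_open G \<longrightarrow> (\<exists>v\<in>D. eq_ae_on m G u v)}"

text \<open>
  \<open>\<mu>\<^sup>(\<^sup>c\<^sup>)(u)\<close> for \<open>u\<close> in the local space: the measure that agrees with
  \<open>\<mu>\<^sup>(\<^sup>c\<^sup>)(v)\<close> on \<open>G\<close> whenever \<open>u = v\<close> on \<open>G\<close>.
  It is unique because \<open>X\<close> is a countable union of open relatively compact sets.
\<close>

definition mu_c ::
  "'a::topological_space measure \<Rightarrow> ('a \<Rightarrow> real) set \<Rightarrow>
   (('a \<Rightarrow> real) \<Rightarrow> ('a \<Rightarrow> real) \<Rightarrow> 'a set \<Rightarrow> real) \<Rightarrow> ('a \<Rightarrow> real) \<Rightarrow> 'a measure" where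
  "mu_c m D \<Gamma> u =
     (THE \<nu>. sets \<nu> = sets borel \<and>
        (\<forall>G. \<forall>v\<in>D. relatively_compact_open G \<and> eq_ae_on m G u v \<longrightarrow>
           (\<forall>B\<in>sets borel. B \<subseteq> G \<longrightarrow> emeasure \<nu> B = ennreal (\<Gamma> v v B))))"

definition mu_b ::
  "'a::topological_space measure \<Rightarrow> ('a \<Rightarrow> real) set \<Rightarrow>
   (('a \<Rightarrow> real) \<Rightarrow> ('a \<Rightarrow> real) \<Rightarrow> real) \<Rightarrow> ('a \<times> 'a) measure \<Rightarrow> ('a \<Rightarrow> real) \<Rightarrow> 'a set \<Rightarrow> ennreal" where
  "mu_b m D \<E> J u B =
     (\<integral>\<^sup>+ (x, y). ennreal ((qc_rep m D \<E> u x - qc_rep m D \<E> u y)\<^sup>2) * indicator B x \<partial>J)"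

definition D_loc_star ::
  "'a::topological_space measure \<Rightarrow> ('a \<Rightarrow> real) set \<Rightarrow>
   (('a \<Rightarrow> real) \<Rightarrow> ('a \<Rightarrow> real) \<Rightarrow> real) \<Rightarrow> ('a \<times> 'a) measure \<Rightarrow> ('a \<Rightarrow> real) set" where
  "D_loc_star m D \<E> J = {u \<in> D_loc m D. \<forall>K. compact K \<longrightarrow> mu_b m D \<E> J u K < \<infinity>}"


section \<open>Intrinsic metrics\<close>

definition pseudo_metric :: "('a \<Rightarrow> 'a \<Rightarrow> ennreal) \<Rightarrow> bool" where
  "pseudo_metric \<rho> \<longleftrightarrow>
     (\<forall>x. \<rho> x x = 0) \<and> (\<forall>x y. \<rho> x y = \<rho> y x) \<and> (\<forall>x y z. \<rho> x z \<le> \<rho> x y + \<rho> y z)"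

text \<open>
  The function \<open>\<rho>\<^sub>A \<and> T\<close>.  For empty \<open>A\<close> the infimum is \<open>\<infinity>\<close> and the function
  is the constant \<open>T\<close>.
\<close>

definition trunc_dist :: "('a \<Rightarrow> 'a \<Rightarrow> ennreal) \<Rightarrow> 'a set \<Rightarrow> real \<Rightarrow> 'a \<Rightarrow> real" where
  "trunc_dist \<rho> A T x = enn2real (min (INF y\<in>A. \<rho> x y) (ennreal T))"

definition intrinsic_metric ::
  "'a::topological_space measure \<Rightarrow> ('a \<Rightarrow> real) set \<Rightarrow>
   (('a \<Rightarrow> real) \<Rightarrow> ('a \<Rightarrow> real) \<Rightarrow> real) \<Rightarrow> ('a \<times> 'a) measure \<Rightarrow>
   (('a \<Rightarrow> real) \<Rightarrow> ('a \<Rightarrow> real) \<Rightarrow> 'a set \<Rightarrow> real) \<Rightarrow> ('a \<Rightarrow> 'a \<Rightarrow> ennreal) \<Rightarrow> bool" where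
  "intrinsic_metric m D \<E> J \<Gamma> \<rho> \<longleftrightarrow>
     pseudo_metric \<rho> \<and>
     (\<exists>m\<^sub>b m\<^sub>c. radon_measure m\<^sub>b \<and> radon_measure m\<^sub>c \<and>
        (\<forall>B\<in>sets borel. emeasure m\<^sub>b B + emeasure m\<^sub>c B \<le> emeasure m B) \<and>
        (\<forall>A. \<forall>T>0.
           trunc_dist \<rho> A T \<in> D_loc_star m D \<E> J \<inter> C_space \<and>
           (\<forall>B\<in>sets borel. mu_b m D \<E> J (trunc_dist \<rho> A T) B \<le> emeasure m\<^sub>b B) \<and>
           (\<forall>B\<in>sets borel. emeasure (mu_c m D \<Gamma> (trunc_dist \<rho> A T)) B \<le> emeasure m\<^sub>c B)))"

text \<open>
  \<open>ennreal\<close> maps negative differences to \<open>0\<close>, which does not change the supremum: the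
  zero function is admissible.
\<close>

definition energy_dist ::
  "'a::topological_space measure \<Rightarrow> ('a \<Rightarrow> real) set \<Rightarrow>
   (('a \<Rightarrow> real) \<Rightarrow> ('a \<Rightarrow> real) \<Rightarrow> 'a set \<Rightarrow> real) \<Rightarrow> 'a \<Rightarrow> 'a \<Rightarrow> ennreal" where
  "energy_dist m D \<Gamma> x y =
     (SUP u\<in>{u \<in> D_loc m D \<inter> C_space.
              \<forall>B\<in>sets borel. emeasure (mu_c m D \<Gamma> u) B \<le> emeasure m B}.
        ennreal (u x - u y))"

end

theory Submission
  imports Defs
begin

text \<open>
  Call a continuous function subunit if it lies locally in the form domain and its energy measure
  is at most \<open>m\<close>.  By definition \<open>\<rho>(x,y)\<close> is the supremum of \<open>u(x) - u(y)\<close> over the subunit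
  functions \<open>u\<close>.  If \<open>\<sigma>\<close> is an intrinsic metric, then \<open>\<sigma>(\<cdot>,y) \<and> T\<close> is itself subunit, vanishes at
  \<open>y\<close>, and so bounds \<open>\<rho>(\<cdot>,y)\<close> from below; letting \<open>T\<close> grow gives \<open>\<sigma> \<le> \<rho>\<close>.

  In the other direction, \<open>\<rho>\<^sub>A \<and> T\<close> is an infimum over \<open>y \<in> A\<close> of suprema, over all subunit \<open>u\<close>,
  of the truncations of \<open>u - u(y)\<close> to \<open>[0,T]\<close>.  So it is enough that subunit functions with
  values in \<open>[0,T]\<close> are stable under pointwise suprema and infima.  There are two steps.

  For finitely many functions this is the truncation property: \<open>min f g\<close> has the energy measure of
  \<open>f\<close> on \<open>{f \<le> g}\<close> and that of \<open>g\<close> elsewhere.  It follows from \<open>Gamma_zero_set\<close>, which says that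
  the energy measure of \<open>u\<close> does not charge \<open>{u = 0}\<close>.

  For infinitely many functions, every subunit function is 1-Lipschitz for \<open>\<rho>\<close>, and \<open>\<rho>\<close> is
  continuous and vanishes on the diagonal.  Thus subunit functions are equicontinuous, and on a
  compact set the supremum is a uniform limit of finite maxima.  Lemma
  \<open>subunit_locally_uniform_limit\<close> shows that such limits are again subunit.

  Both \<open>Gamma_zero_set\<close> and \<open>subunit_locally_uniform_limit\<close> come from
  \<open>dirichlet_convex_approximation\<close>: if elements of bounded energy of a convex set \<open>P\<close> converge to
  \<open>v\<close> in \<open>L\<^sup>2\<close>, then \<open>v\<close> lies in the domain and is a limit of elements of \<open>P\<close> in the energy
  seminorm.  Conditions of the form \<open>\<mu>(w)(B) \<le> c\<close> define convex sets of \<open>w\<close> and are preserved by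
  such limits.

  All estimates are made for functions of the domain that are continuous with compact support.
  These are their own quasi-continuous representatives, so that the formula of Beurling and Deny
  applies to them directly and bounds the energy measure by the form.
\<close>


section \<open>Non-negative quadratic forms\<close>

locale nonneg_form =
  fixes D :: "('a \<Rightarrow> real) set" and q :: "('a \<Rightarrow> real) \<Rightarrow> ('a \<Rightarrow> real) \<Rightarrow> real"
  assumes lin: "\<And>u v a b. u \<in> D \<Longrightarrow> v \<in> D \<Longrightarrow> (\<lambda>x. a * u x + b * v x) \<in> D"
    and bilinear: "symmetric_bilinear_on D q"
    and nonneg: "\<And>u. u \<in> D \<Longrightarrow> 0 \<le> q u u"
begin

lemma add_mem: "u \<in> D \<Longrightarrow> v \<in> D \<Longrightarrow> (\<lambda>x. u x + v x) \<in> D"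
  using lin[of u v 1 1] by simp

lemma diff_mem: "u \<in> D \<Longrightarrow> v \<in> D \<Longrightarrow> (\<lambda>x. u x - v x) \<in> D"
  using lin[of u v 1 "-1"] by simp

lemma scale_mem: "u \<in> D \<Longrightarrow> (\<lambda>x. a * u x) \<in> D"
  using lin[of u u a 0] by simp

lemma form_lincomb:
  assumes "u \<in> D" "v \<in> D"
  shows "q (\<lambda>x. a * u x + b * v x) (\<lambda>x. a * u x + b * v x)
    = a\<^sup>2 * q u u + 2 * a * b * q u v + b\<^sup>2 * q v v"
proof -
  have left: "q (\<lambda>x. a * f x + b * g x) w = a * q f w + b * q g w" and sym: "q f w = q w f"
    if "f \<in> D" "g \<in> D" "w \<in> D" for a b f g w
    using bilinear that unfolding symmetric_bilinear_on_def by blast+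
  let ?w = "\<lambda>x. a * u x + b * v x"
  have w: "?w \<in> D" using lin assms by blast
  have "q u ?w = a * q u u + b * q u v" "q v ?w = a * q u v + b * q v v"
    using left[OF assms assms(1), of a b] left[OF assms assms(2), of a b]
      sym[OF assms(1) w w] sym[OF assms(2) w w] sym[OF assms w] by (simp_all add: sym[OF assms(2,1) assms(1)])
  then have "q ?w ?w = a * (a * q u u + b * q u v) + b * (a * q u v + b * q v v)"
    using left[OF assms w] by simp
  also have "\<dots> = a\<^sup>2 * q u u + 2 * a * b * q u v + b\<^sup>2 * q v v"
    by (simp add: power2_eq_square algebra_simps)
  finally show ?thesis .
qed

lemma form_scale: "u \<in> D \<Longrightarrow> q (\<lambda>x. a * u x) (\<lambda>x. a * u x) = a\<^sup>2 * q u u"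
  using form_lincomb[of u u a 0] by simp

lemma form_add:
  "u \<in> D \<Longrightarrow> v \<in> D \<Longrightarrow> q (\<lambda>x. u x + v x) (\<lambda>x. u x + v x) = q u u + 2 * q u v + q v v"
  using form_lincomb[of u v 1 1] by simp

lemma form_diff:
  "u \<in> D \<Longrightarrow> v \<in> D \<Longrightarrow> q (\<lambda>x. u x - v x) (\<lambda>x. u x - v x) = q u u - 2 * q u v + q v v"
  using form_lincomb[of u v 1 "-1"] by simp

lemma form_diff_commute:
  "u \<in> D \<Longrightarrow> v \<in> D \<Longrightarrow> q (\<lambda>x. u x - v x) (\<lambda>x. u x - v x) = q (\<lambda>x. v x - u x) (\<lambda>x. v x - u x)"
  using form_scale[OF diff_mem, of u v "-1"] by simp

text \<open>
  The parallelogram identity.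
\<close>

lemma form_midpoint:
  assumes "u \<in> D" "v \<in> D"
  shows "q (\<lambda>x. (u x + v x) / 2) (\<lambda>x. (u x + v x) / 2)
    = q u u / 2 + q v v / 2 - q (\<lambda>x. u x - v x) (\<lambda>x. u x - v x) / 4"
proof -
  have "(\<lambda>x. (u x + v x) / 2) = (\<lambda>x. 1/2 * u x + 1/2 * v x)"
    by (simp add: add_divide_distrib)
  then show ?thesis
    by (simp only: form_lincomb[OF assms] form_diff[OF assms]) (simp add: power2_eq_square field_simps)
qed

lemma form_midpoint_le:
  assumes "u \<in> D" "v \<in> D" "q u u \<le> c" "q v v \<le> c"
  shows "q (\<lambda>x. (u x + v x) / 2) (\<lambda>x. (u x + v x) / 2) \<le> c"
  using eq_refl[OF form_midpoint[OF assms(1,2)]] nonneg[OF diff_mem[OF assms(1,2)]] assms(3,4)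
  by linarith

text \<open>Expand the square of \<open>t u - v\<close>, which is a scaling free form of the triangle
  inequality for the seminorm of \<open>q\<close>.\<close>

lemma form_add_le:
  assumes "u \<in> D" "v \<in> D" "0 < t"
  shows "q (\<lambda>x. u x + v x) (\<lambda>x. u x + v x) \<le> (1 + t) * q u u + (1 + 1 / t) * q v v"
proof -
  have "0 \<le> q (\<lambda>x. t * u x + (-1) * v x) (\<lambda>x. t * u x + (-1) * v x)"
    using nonneg lin assms(1,2) by blast
  then have "2 * t * q u v \<le> t\<^sup>2 * q u u + q v v"
    unfolding form_lincomb[OF assms(1,2)] by simp
  then have "2 * t * q u v / t \<le> (t\<^sup>2 * q u u + q v v) / t"
    using assms(3) by (intro divide_right_mono) auto
  then have "2 * q u v \<le> t * q u u + q v v / t"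
    using assms(3) by (simp add: add_divide_distrib power2_eq_square)
  then show ?thesis
    using form_add[OF assms(1,2)] by (simp add: algebra_simps)
qed

lemma form_add_null_le:
  assumes "u \<in> D" "v \<in> D" "q v v = 0"
  shows "q (\<lambda>x. u x + v x) (\<lambda>x. u x + v x) \<le> q u u"
proof (rule field_le_epsilon)
  fix e :: real assume e: "0 < e"
  \<comment> \<open>The one in the denominator covers the case \<open>q u u = 0\<close>.\<close>
  define t where "t = e / (1 + q u u)"
  have n: "0 \<le> q u u" using nonneg assms by blast
  then have t: "0 < t" "t * q u u \<le> e"
    using e by (auto simp: t_def field_simps)
  then show "q (\<lambda>x. u x + v x) (\<lambda>x. u x + v x) \<le> q u u + e"
    using form_add_le[OF assms(1,2) t(1)] assms(3) by (simp add: algebra_simps)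
qed

lemma form_add_null:
  assumes "u \<in> D" "v \<in> D" "q v v = 0"
  shows "q (\<lambda>x. u x + v x) (\<lambda>x. u x + v x) = q u u"
proof (rule antisym[OF form_add_null_le[OF assms]])
  have "q (\<lambda>x. - 1 * v x) (\<lambda>x. - 1 * v x) = 0"
    using form_scale[of v "-1"] assms by simp
  then show "q u u \<le> q (\<lambda>x. u x + v x) (\<lambda>x. u x + v x)"
    using form_add_null_le[OF add_mem[OF assms(1,2)] scale_mem[OF assms(2)], of "-1"] by simp
qed

text \<open>Sublevel sets of \<open>q\<close> are closed for the seminorm of \<open>q\<close>.\<close>

lemma form_le_of_approx:
  assumes v: "v \<in> D"
    and approx: "\<And>\<epsilon>. 0 < \<epsilon> \<Longrightarrow> \<exists>w\<in>D. q w w \<le> c \<and> q (\<lambda>x. w x - v x) (\<lambda>x. w x - v x) < \<epsilon>"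
  shows "q v v \<le> c"
proof (rule field_le_epsilon)
  fix e :: real assume e: "0 < e"
  have c: "0 \<le> c" using approx[of 1] nonneg by force
  define t where "t = e / (2 * (1 + c))"
  have "(2 * c) * e < e * (2 + c * 2)" using e by (simp add: algebra_simps)
  then have t: "0 < t" "t * c \<le> e / 2"
    using e c by (auto simp: t_def field_simps)
  define s where "s = 1 + 1 / t"
  have s: "0 < s" using t by (simp add: s_def add_pos_pos)
  define \<epsilon> where "\<epsilon> = e / (2 * s)"
  have eps: "0 < \<epsilon>" "s * \<epsilon> = e / 2"
    using e s by (auto simp: \<epsilon>_def)
  from approx[OF eps(1)] obtain w where w: "w \<in> D" "q w w \<le> c"
    "q (\<lambda>x. w x - v x) (\<lambda>x. w x - v x) < \<epsilon>" by blast
  have "q v v \<le> (1 + t) * q w w + s * q (\<lambda>x. v x - w x) (\<lambda>x. v x - w x)"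
    using form_add_le[OF w(1) diff_mem[OF v w(1)] t(1)] by (simp add: s_def)
  also have "\<dots> \<le> (1 + t) * c + s * \<epsilon>"
    using w(2,3) t(1) s form_diff_commute[OF v w(1)]
    by (intro add_mono mult_left_mono) auto
  also have "\<dots> \<le> c + e"
    using eps t by (simp add: algebra_simps)
  finally show "q v v \<le> c + e" .
qed

end


section \<open>Approximation by convex sets of bounded energy\<close>

lemma L2_space_lincomb:
  assumes "u \<in> L2_space m" "v \<in> L2_space m"
  shows "(\<lambda>x. a * u x + b * v x) \<in> L2_space m"
proof -
  have [measurable]: "u \<in> borel_measurable m" "v \<in> borel_measurable m"
    and int: "integrable m (\<lambda>x. (u x)\<^sup>2)" "integrable m (\<lambda>x. (v x)\<^sup>2)"
    using assms by (auto simp: L2_space_def)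
  have "integrable m (\<lambda>x. (a * u x + b * v x)\<^sup>2)"
  proof (rule Bochner_Integration.integrable_bound)
    show "integrable m (\<lambda>x. 2 * a\<^sup>2 * (u x)\<^sup>2 + 2 * b\<^sup>2 * (v x)\<^sup>2)"
      using int by simp
    have "(a * u x + b * v x)\<^sup>2 \<le> 2 * a\<^sup>2 * (u x)\<^sup>2 + 2 * b\<^sup>2 * (v x)\<^sup>2" for x
      using zero_le_power2[of "a * u x - b * v x"]
      by (simp add: power2_eq_square algebra_simps)
    then show "AE x in m. norm ((a * u x + b * v x)\<^sup>2)
        \<le> norm (2 * a\<^sup>2 * (u x)\<^sup>2 + 2 * b\<^sup>2 * (v x)\<^sup>2)"
      by simp
  qed simp
  then show ?thesis by (simp add: L2_space_def)
qed

lemma L2_space_diff: "u \<in> L2_space m \<Longrightarrow> v \<in> L2_space m \<Longrightarrow> (\<lambda>x. u x - v x) \<in> L2_space m"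
  using L2_space_lincomb[of u m v 1 "-1"] by simp

lemma L2_dist_triangle:
  assumes "u \<in> L2_space m" "v \<in> L2_space m" "w \<in> L2_space m"
  shows "(\<integral>x. (u x - w x)\<^sup>2 \<partial>m)
    \<le> 2 * (\<integral>x. (u x - v x)\<^sup>2 \<partial>m) + 2 * (\<integral>x. (w x - v x)\<^sup>2 \<partial>m)"
proof -
  have int: "integrable m (\<lambda>x. (f x - g x)\<^sup>2)" if "f \<in> L2_space m" "g \<in> L2_space m" for f g
    using L2_space_diff[OF that] by (simp add: L2_space_def)
  have "(u x - w x)\<^sup>2 \<le> 2 * (u x - v x)\<^sup>2 + 2 * (w x - v x)\<^sup>2" for x
    using zero_le_power2[of "(u x - v x) + (w x - v x)"]
    by (simp add: power2_eq_square algebra_simps)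
  then have "(\<integral>x. (u x - w x)\<^sup>2 \<partial>m) \<le> (\<integral>x. 2 * (u x - v x)\<^sup>2 + 2 * (w x - v x)\<^sup>2 \<partial>m)"
    using int assms by (intro integral_mono) auto
  also have "\<dots> = 2 * (\<integral>x. (u x - v x)\<^sup>2 \<partial>m) + 2 * (\<integral>x. (w x - v x)\<^sup>2 \<partial>m)"
    using int assms by simp
  finally show ?thesis .
qed

lemma L2_dist_midpoint:
  assumes "u \<in> L2_space m" "v \<in> L2_space m" "w \<in> L2_space m"
    and "(\<integral>x. (u x - v x)\<^sup>2 \<partial>m) \<le> \<delta>" "(\<integral>x. (w x - v x)\<^sup>2 \<partial>m) \<le> \<delta>"
  shows "(\<integral>x. ((u x + w x) / 2 - v x)\<^sup>2 \<partial>m) \<le> \<delta>"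
proof -
  have int: "integrable m (\<lambda>x. (f x - g x)\<^sup>2)" if "f \<in> L2_space m" "g \<in> L2_space m" for f g
    using L2_space_diff[OF that] by (simp add: L2_space_def)
  have mid: "(\<lambda>x. (u x + w x) / 2) \<in> L2_space m"
    using L2_space_lincomb[OF assms(1,3), of "1/2" "1/2"] by (simp add: add_divide_distrib)
  have "((u x + w x) / 2 - v x)\<^sup>2 \<le> (u x - v x)\<^sup>2 / 2 + (w x - v x)\<^sup>2 / 2" for x
    using zero_le_power2[of "(u x - v x) - (w x - v x)"]
    by (simp add: power2_eq_square field_simps)
  then have "(\<integral>x. ((u x + w x) / 2 - v x)\<^sup>2 \<partial>m)
      \<le> (\<integral>x. (u x - v x)\<^sup>2 / 2 + (w x - v x)\<^sup>2 / 2 \<partial>m)"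
    using int[OF mid assms(2)] int[OF assms(1,2)] int[OF assms(3,2)]
    by (intro integral_mono) auto
  also have "\<dots> = (\<integral>x. (u x - v x)\<^sup>2 \<partial>m) / 2 + (\<integral>x. (w x - v x)\<^sup>2 \<partial>m) / 2"
    using int[OF assms(1,2)] int[OF assms(3,2)] by simp
  finally show ?thesis using assms(4,5) by linarith
qed

lemma dirichlet_formD:
  assumes "dirichlet_form m D \<E>"
  shows dirichlet_L2: "D \<subseteq> L2_space m"
    and dirichlet_class_mem:
      "\<lbrakk>u \<in> D; v \<in> borel_measurable m; AE x in m. u x = v x\<rbrakk> \<Longrightarrow> v \<in> D"
    and dirichlet_class_form:
      "\<lbrakk>u \<in> D; v \<in> borel_measurable m; AE x in m. u x = v x; w \<in> D\<rbrakk> \<Longrightarrow> \<E> u w = \<E> v w"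
    and dirichlet_zero: "(\<lambda>_. 0) \<in> D"
    and dirichlet_nonneg_form: "nonneg_form D \<E>"
    and dirichlet_complete: "\<lbrakk>\<And>n. f n \<in> D;
        \<And>\<epsilon>. 0 < \<epsilon> \<Longrightarrow> \<exists>N. \<forall>i\<ge>N. \<forall>j\<ge>N. form_E1 m \<E> (\<lambda>x. f i x - f j x) < \<epsilon>\<rbrakk>
      \<Longrightarrow> \<exists>u\<in>D. (\<lambda>n::nat. form_E1 m \<E> (\<lambda>x. f n x - u x)) \<longlonglongrightarrow> 0"
    and dirichlet_contraction:
      "\<lbrakk>normal_contraction T; w \<in> D\<rbrakk> \<Longrightarrow> T \<circ> w \<in> D \<and> \<E> (T \<circ> w) (T \<circ> w) \<le> \<E> w w"
proof -
  note df = assms[unfolded dirichlet_form_def]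
  note df2 = df[THEN conjunct2, THEN conjunct2, THEN conjunct2]
  note df3 = df2[THEN conjunct2, THEN conjunct2, THEN conjunct2]
  show "D \<subseteq> L2_space m" by (rule df[THEN conjunct1])
  show "\<lbrakk>u \<in> D; v \<in> borel_measurable m; AE x in m. u x = v x\<rbrakk> \<Longrightarrow> v \<in> D"
    "\<lbrakk>u \<in> D; v \<in> borel_measurable m; AE x in m. u x = v x; w \<in> D\<rbrakk> \<Longrightarrow> \<E> u w = \<E> v w"
    using df[THEN conjunct2, THEN conjunct1] by blast+
  show "(\<lambda>_. 0) \<in> D" by (rule df[THEN conjunct2, THEN conjunct2, THEN conjunct1])
  show "nonneg_form D \<E>"
    using df2[THEN conjunct1] df3[THEN conjunct1] df2[THEN conjunct2, THEN conjunct2, THEN conjunct1]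
    unfolding nonneg_form_def by simp
  show "\<lbrakk>\<And>n. f n \<in> D;
        \<And>\<epsilon>. 0 < \<epsilon> \<Longrightarrow> \<exists>N. \<forall>i\<ge>N. \<forall>j\<ge>N. form_E1 m \<E> (\<lambda>x. f i x - f j x) < \<epsilon>\<rbrakk>
      \<Longrightarrow> \<exists>u\<in>D. (\<lambda>n::nat. form_E1 m \<E> (\<lambda>x. f n x - u x)) \<longlonglongrightarrow> 0"
    by (rule df3[THEN conjunct2, THEN conjunct1, rule_format]) blast
  show "\<lbrakk>normal_contraction T; w \<in> D\<rbrakk> \<Longrightarrow> T \<circ> w \<in> D \<and> \<E> (T \<circ> w) (T \<circ> w) \<le> \<E> w w"
    by (rule df3[THEN conjunct2, THEN conjunct2, rule_format])
qed

text \<open>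
  A form of the Banach--Saks theorem, by convex minimization.  Minimize the energy over the elements of \<open>P\<close> within
  \<open>L\<^sup>2\<close>-distance \<open>sqrt \<delta>\<close> of \<open>v\<close>.  The infimum increases as \<open>\<delta>\<close> decreases and is bounded by \<open>C\<close>,
  so it converges.  The midpoint of two almost minimizers competes in the same minimization, hence
  by the parallelogram identity almost minimizers form a Cauchy sequence for the energy.  By
  closedness the sequence converges, and its limit can only be \<open>v\<close>.
\<close>

lemma dirichlet_convex_approximation:
  assumes df: "dirichlet_form m D \<E>"
    and P: "P \<subseteq> D"
    and mid: "\<And>u w. u \<in> P \<Longrightarrow> w \<in> P \<Longrightarrow> (\<lambda>x. (u x + w x) / 2) \<in> P"
    and v: "v \<in> L2_space m"
    and approx: "\<And>\<epsilon>. 0 < \<epsilon> \<Longrightarrow> \<exists>w\<in>P. \<E> w w \<le> C \<and> (\<integral>x. (w x - v x)\<^sup>2 \<partial>m) \<le> \<epsilon>"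
  shows "v \<in> D" and "0 < \<epsilon> \<Longrightarrow> \<exists>w\<in>P. \<E> (\<lambda>x. w x - v x) (\<lambda>x. w x - v x) < \<epsilon>"
proof -
  interpret nonneg_form D \<E> by (rule dirichlet_nonneg_form[OF df])
  have L2: "u \<in> L2_space m" if "u \<in> D" for u
    using dirichlet_L2[OF df] that by blast
  define Q where "Q \<delta> = {w\<in>P. (\<integral>x. (w x - v x)\<^sup>2 \<partial>m) \<le> \<delta>}" for \<delta>
  define c where "c \<delta> = Inf ((\<lambda>w. \<E> w w) ` Q \<delta>)" for \<delta>
  define \<delta> where "\<delta> n = 1 / real (Suc n)" for n
  have \<delta>_pos: "0 < \<delta> n" for n by (simp add: \<delta>_def)
  have \<delta>_mono: "\<delta> j \<le> \<delta> i" if "i \<le> j" for i j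
    using that by (simp add: \<delta>_def frac_le)
  have \<delta>_lim: "\<delta> \<longlonglongrightarrow> 0"
    unfolding \<delta>_def using LIMSEQ_inverse_real_of_nat by (simp add: inverse_eq_divide)
  have bdd: "bdd_below ((\<lambda>w. \<E> w w) ` Q d)" for d
    using P nonneg by (intro bdd_belowI[of _ 0]) (auto simp: Q_def)
  have c_le: "c d \<le> \<E> w w" if "w \<in> Q d" for w d
    unfolding c_def using bdd that by (intro cInf_lower) auto
  have nonempty: "Q d \<noteq> {}" if "0 < d" for d
    using approx[OF that] by (auto simp: Q_def)
  have c_mono: "c (\<delta> i) \<le> c (\<delta> j)" if "i \<le> j" for i j
  proof -
    have "Q (\<delta> j) \<subseteq> Q (\<delta> i)" using \<delta>_mono[OF that] by (auto simp: Q_def)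
    then show ?thesis
      unfolding c_def using nonempty[OF \<delta>_pos] bdd by (intro cInf_superset_mono) auto
  qed
  have c_bound: "c (\<delta> i) \<le> C" for i
    using approx[OF \<delta>_pos[of i]] c_le[of _ "\<delta> i"] unfolding Q_def by force
  have "convergent (\<lambda>i. c (\<delta> i))"
  proof (rule Bseq_monoseq_convergent)
    show "monoseq (\<lambda>i. c (\<delta> i))" using c_mono by (intro monoI1) auto
    have "\<bar>c (\<delta> i)\<bar> \<le> max \<bar>C\<bar> \<bar>c (\<delta> 0)\<bar>" for i
      using c_bound[of i] c_mono[of 0 i] by auto
    then show "Bseq (\<lambda>i. c (\<delta> i))" by (intro BseqI'[of _ "max \<bar>C\<bar> \<bar>c (\<delta> 0)\<bar>"]) simp
  qed
  then obtain L where L: "(\<lambda>i. c (\<delta> i)) \<longlonglongrightarrow> L" by (auto simp: convergent_def)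
  have c_le_L: "c (\<delta> i) \<le> L" for i
    using L c_mono by (intro incseq_le) (auto simp: incseq_def)
  have "\<exists>w\<in>Q (\<delta> n). \<E> w w < c (\<delta> n) + \<delta> n" for n
    using cInf_lessD[of "(\<lambda>w. \<E> w w) ` Q (\<delta> n)" "c (\<delta> n) + \<delta> n"] nonempty[OF \<delta>_pos] \<delta>_pos[of n]
    unfolding c_def by auto
  then obtain w where w: "\<And>n. w n \<in> Q (\<delta> n)" "\<And>n. \<E> (w n) (w n) < c (\<delta> n) + \<delta> n" by metis
  have wP: "w n \<in> P" and wD: "w n \<in> D" and wv: "(\<integral>x. (w n x - v x)\<^sup>2 \<partial>m) \<le> \<delta> n" for n
    using w(1)[of n] P by (auto simp: Q_def)
  have energy: "\<E> (\<lambda>x. w i x - w j x) (\<lambda>x. w i x - w j x) \<le> 4 * (L - c (\<delta> N) + \<delta> N)"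
    if "N \<le> i" "N \<le> j" for i j N
  proof -
    have "(\<lambda>x. (w i x + w j x) / 2) \<in> Q (\<delta> N)"
      using mid[OF wP wP, of i j] wv[of i] wv[of j] \<delta>_mono[OF that(1)] \<delta>_mono[OF that(2)]
        L2_dist_midpoint[OF L2[OF wD] v L2[OF wD], of i "\<delta> N" j]
      by (auto simp: Q_def)
    from c_le[OF this]
    have "c (\<delta> N) \<le> \<E> (w i) (w i) / 2 + \<E> (w j) (w j) / 2
        - \<E> (\<lambda>x. w i x - w j x) (\<lambda>x. w i x - w j x) / 4"
      by (simp only: form_midpoint[OF wD wD])
    moreover have "\<E> (w i) (w i) \<le> L + \<delta> N" "\<E> (w j) (w j) \<le> L + \<delta> N"
      using w(2)[of i] w(2)[of j] c_le_L[of i] c_le_L[of j]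
        \<delta>_mono[OF that(1)] \<delta>_mono[OF that(2)] by linarith+
    ultimately show ?thesis by argo
  qed
  have cauchy: "form_E1 m \<E> (\<lambda>x. w i x - w j x) \<le> 4 * (L - c (\<delta> N)) + 8 * \<delta> N"
    if "N \<le> i" "N \<le> j" for i j N
  proof -
    have "(\<integral>x. (w i x - v x)\<^sup>2 \<partial>m) \<le> \<delta> N" "(\<integral>x. (w j x - v x)\<^sup>2 \<partial>m) \<le> \<delta> N"
      using wv[of i] wv[of j] \<delta>_mono[OF that(1)] \<delta>_mono[OF that(2)] by linarith+
    then have "(\<integral>x. (w i x - w j x)\<^sup>2 \<partial>m) \<le> 4 * \<delta> N"
      using L2_dist_triangle[OF L2[OF wD] v L2[OF wD], of i j] by argo
    then show ?thesis
      using energy[OF that] unfolding form_E1_def by argo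
  qed
  have "(\<lambda>N. 4 * (L - c (\<delta> N)) + 8 * \<delta> N) \<longlonglongrightarrow> 4 * (L - L) + 8 * 0"
    by (intro tendsto_intros L \<delta>_lim)
  then have bound0: "(\<lambda>N. 4 * (L - c (\<delta> N)) + 8 * \<delta> N) \<longlonglongrightarrow> 0" by simp
  have "\<exists>N. \<forall>i\<ge>N. \<forall>j\<ge>N. form_E1 m \<E> (\<lambda>x. w i x - w j x) < \<epsilon>" if eps: "0 < \<epsilon>" for \<epsilon>
  proof -
    obtain N where "4 * (L - c (\<delta> N)) + 8 * \<delta> N < \<epsilon>"
      using order_tendstoD(2)[OF bound0 eps] by (auto simp: eventually_sequentially)
    then show ?thesis by (intro exI[of _ N] allI impI) (rule le_less_trans[OF cauchy])
  qed
  then obtain u where u: "u \<in> D" "(\<lambda>n. form_E1 m \<E> (\<lambda>x. w n x - u x)) \<longlonglongrightarrow> 0"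
    using dirichlet_complete[of m D \<E> w, OF df wD] by blast
  have E_nonneg: "0 \<le> \<E> (\<lambda>x. w n x - u x) (\<lambda>x. w n x - u x)" for n
    using nonneg[OF diff_mem[OF wD u(1)]] .
  have L2_nonneg: "0 \<le> (\<integral>x. (w n x - u x)\<^sup>2 \<partial>m)" for n by simp
  have "(\<integral>x. (u x - v x)\<^sup>2 \<partial>m) \<le> 2 * form_E1 m \<E> (\<lambda>x. w n x - u x) + 2 * \<delta> n" for n
  proof -
    have "(\<integral>x. (u x - w n x)\<^sup>2 \<partial>m) = (\<integral>x. (w n x - u x)\<^sup>2 \<partial>m)"
      "(\<integral>x. (v x - w n x)\<^sup>2 \<partial>m) = (\<integral>x. (w n x - v x)\<^sup>2 \<partial>m)"
      by (simp_all add: power2_commute)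
    then show ?thesis
      using L2_dist_triangle[OF L2[OF u(1)] L2[OF wD] v, of n] E_nonneg[of n] wv[of n]
      unfolding form_E1_def by simp
  qed
  moreover have "(\<lambda>n. 2 * form_E1 m \<E> (\<lambda>x. w n x - u x) + 2 * \<delta> n) \<longlonglongrightarrow> 2 * 0 + 2 * 0"
    by (intro tendsto_intros u(2) \<delta>_lim)
  ultimately have "(\<integral>x. (u x - v x)\<^sup>2 \<partial>m) \<le> 0"
    by (intro LIMSEQ_le_const[of _ 0]) auto
  then have "(\<integral>x. (u x - v x)\<^sup>2 \<partial>m) = 0"
    by (intro antisym) simp_all
  then have "AE x in m. (u x - v x)\<^sup>2 = 0"
    using integral_nonneg_eq_0_iff_AE[of m "\<lambda>x. (u x - v x)\<^sup>2"] L2_space_diff[OF L2[OF u(1)] v]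
    by (simp add: L2_space_def)
  then have ae: "AE x in m. u x = v x" by simp
  show vD: "v \<in> D"
    using dirichlet_class_mem[OF df u(1) _ ae] v by (simp add: L2_space_def)
  assume "0 < \<epsilon>"
  then obtain n where n: "form_E1 m \<E> (\<lambda>x. w n x - u x) < \<epsilon>"
    using order_tendstoD(2)[OF u(2)] by (auto simp: eventually_sequentially)
  let ?a = "\<lambda>x. w n x - u x" and ?b = "\<lambda>x. w n x - v x"
  have mem: "?a \<in> D" "?b \<in> D" using diff_mem wD u(1) vD by blast+
  have "AE x in m. ?a x = ?b x" using ae by eventually_elim simp
  moreover have "?b \<in> borel_measurable m" using L2[OF mem(2)] by (simp add: L2_space_def)
  ultimately have "\<E> ?a ?a = \<E> ?b ?a" "\<E> ?a ?b = \<E> ?b ?b"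
    using dirichlet_class_form[OF df mem(1)] mem by blast+
  moreover have "\<E> ?a ?b = \<E> ?b ?a"
    using bilinear mem unfolding symmetric_bilinear_on_def by blast
  moreover have "\<E> ?a ?a < \<epsilon>"
    using n L2_nonneg[of n] unfolding form_E1_def by linarith
  ultimately have "\<E> ?b ?b < \<epsilon>" by simp
  then show "\<exists>w\<in>P. \<E> (\<lambda>x. w x - v x) (\<lambda>x. w x - v x) < \<epsilon>"
    using wP by blast
qed

lemma ex_small_square: "0 < \<epsilon> \<Longrightarrow> 0 \<le> c \<Longrightarrow> \<exists>\<delta>>0. \<delta>\<^sup>2 * c \<le> (\<epsilon>::real)"
  by (rule exI[of _ "sqrt (\<epsilon> / (c + 1))"]) (simp add: field_simps)


section \<open>Compactly supported functions and relatively compact sets\<close>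

lemma Cc_spaceI:
  fixes u :: "'a::metric_space \<Rightarrow> real"
  assumes "continuous_on UNIV u" "compact K" "\<And>x. x \<notin> K \<Longrightarrow> u x = 0"
  shows "u \<in> Cc_space"
proof -
  have "closure {x. u x \<noteq> 0} \<subseteq> K"
    using assms by (intro closure_minimal compact_imp_closed) auto
  then have "K \<inter> closure {x. u x \<noteq> 0} = closure {x. u x \<noteq> 0}" by blast
  then have "compact (closure {x. u x \<noteq> 0})"
    using compact_Int_closed[OF assms(2), of "closure {x. u x \<noteq> 0}"] by simp
  then show ?thesis using assms(1) by (simp add: Cc_space_def)
qed

lemma Cc_space_support:
  assumes "u \<in> Cc_space"
  shows "\<exists>K. compact K \<and> closed K \<and> (\<forall>x. x \<notin> K \<longrightarrow> u x = 0)"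
proof (intro exI conjI allI impI)
  show "compact (closure {x. u x \<noteq> 0})" using assms by (simp add: Cc_space_def)
  show "closed (closure {x. u x \<noteq> 0})" by (rule closed_closure)
  show "u x = 0" if "x \<notin> closure {x. u x \<noteq> 0}" for x
    using that closure_subset[of "{x. u x \<noteq> 0}"] by blast
qed

lemma relatively_compact_open_subset:
  assumes "relatively_compact_open G" "open U" "U \<subseteq> G"
  shows "relatively_compact_open (U::'a::metric_space set)"
proof -
  have "compact (closure G \<inter> closure U)"
    using assms by (intro compact_Int_closed) (auto simp: relatively_compact_open_def)
  moreover have "closure G \<inter> closure U = closure U"
    using closure_mono[OF assms(3)] by blast
  ultimately show ?thesis using assms(2) by (simp add: relatively_compact_open_def)
qed

lemma relatively_compact_open_Un:
  "relatively_compact_open U \<Longrightarrow> relatively_compact_open V \<Longrightarrow> relatively_compact_open (U \<union> V)"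
  by (auto simp: relatively_compact_open_def)

lemma locally_compact_point_nhd:
  assumes "locally compact (UNIV :: 'a::metric_space set)"
  shows "\<exists>G. relatively_compact_open G \<and> (x::'a) \<in> G"
proof -
  obtain u v where uv: "open u" "compact v" "x \<in> u" "u \<subseteq> v"
    using assms[unfolded locally_def, rule_format, of UNIV x] by auto
  have "closure u \<subseteq> v" using uv by (intro closure_minimal compact_imp_closed) auto
  then have "v \<inter> closure u = closure u" by blast
  then have "compact (closure u)"
    using compact_Int_closed[OF uv(2) closed_closure, of u] by simp
  with uv show ?thesis unfolding relatively_compact_open_def by blast
qed

lemma locally_compact_compact_nhd:
  fixes K :: "'a::metric_space set"
  assumes lc: "locally compact (UNIV :: 'a set)" and K: "compact K"
  shows "\<exists>G. relatively_compact_open G \<and> K \<subseteq> G"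
proof -
  obtain U where U: "\<And>x. relatively_compact_open (U x) \<and> (x::'a) \<in> U x"
    using locally_compact_point_nhd[OF lc] by metis
  have "open (U x)" for x using U[of x] by (simp add: relatively_compact_open_def)
  moreover have "K \<subseteq> (\<Union>x\<in>K. U x)" using U by blast
  ultimately obtain F where F: "F \<subseteq> K" "finite F" "K \<subseteq> (\<Union>x\<in>F. U x)"
    using compactE_image[OF K, of K U] by metis
  have "relatively_compact_open (\<Union>x\<in>F. U x)"
    using F(2)
  proof (induction F rule: finite_induct)
    case empty then show ?case by (simp add: relatively_compact_open_def)
  next
    case (insert x F) then show ?case using U by (simp add: relatively_compact_open_Un)
  qed
  then show ?thesis using F(3) by blast
qed

lemma relatively_compact_exhaustion:
  assumes lc: "locally compact (UNIV :: 'a::{metric_space, second_countable_topology} set)"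
  obtains G :: "nat \<Rightarrow> 'a::{metric_space, second_countable_topology} set"
    where "\<And>n. relatively_compact_open (G n)" "(\<Union>n. G n) = UNIV"
proof -
  let ?\<F> = "{G::'a set. relatively_compact_open G}"
  obtain \<F> where \<F>: "\<F> \<subseteq> ?\<F>" "countable \<F>" "\<Union>\<F> = \<Union>?\<F>"
    using Lindelof[of ?\<F>] by (auto simp: relatively_compact_open_def)
  have un: "\<Union>\<F> = UNIV"
    using \<F>(3) locally_compact_point_nhd[OF lc] by blast
  then have "\<F> \<noteq> {}" by auto
  show thesis
  proof
    show "relatively_compact_open (from_nat_into \<F> n)" for n
      using from_nat_into[OF \<open>\<F> \<noteq> {}\<close>] \<F>(1) by blast
    show "(\<Union>n. from_nat_into \<F> n) = UNIV"
      using range_from_nat_into[OF \<open>\<F> \<noteq> {}\<close> \<F>(2)] un by simp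
  qed
qed

lemma ex_Cc_space_ge_on_compact:
  fixes K :: "'a::metric_space set"
  assumes lc: "locally compact (UNIV :: 'a set)" and K: "compact K"
  shows "\<exists>f\<in>Cc_space. \<forall>x\<in>K. c \<le> f x"
proof -
  obtain G where G: "relatively_compact_open G" "K \<subseteq> G"
    using locally_compact_compact_nhd[OF lc K] by blast
  have op: "open G" and cp: "compact (closure G)"
    using G(1) by (auto simp: relatively_compact_open_def)
  show ?thesis
  proof (cases "K = {} \<or> - G = {}")
    case True
    then show ?thesis
    proof
      assume "K = {}"
      then show ?thesis
        by (intro bexI[of _ "\<lambda>_. 0"] Cc_spaceI[of _ "{}"]) auto
    next
      assume "- G = {}"
      then have "G = UNIV" by blast
      then have "compact (UNIV::'a set)" using cp by simp
      then show ?thesis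
        by (intro bexI[of _ "\<lambda>_. c"] Cc_spaceI[of _ UNIV]) auto
    qed
  next
    case False
    let ?d = "\<lambda>x. infdist x (- G)"
    have cont: "continuous_on S ?d" for S by (intro continuous_intros)
    obtain x0 where x0: "x0 \<in> K" "\<And>x. x \<in> K \<Longrightarrow> ?d x0 \<le> ?d x"
      using continuous_attains_inf[OF K _ cont] False by blast
    have "?d x0 > 0"
      using in_closed_iff_infdist_zero[of "- G" x0] op x0(1) G(2) False infdist_nonneg[of x0 "- G"]
      by (auto simp: less_le)
    show ?thesis
    proof (intro bexI[of _ "\<lambda>x. \<bar>c\<bar> / ?d x0 * ?d x"] ballI Cc_spaceI[OF _ cp])
      show "continuous_on UNIV (\<lambda>x. \<bar>c\<bar> / ?d x0 * ?d x)" by (intro continuous_intros)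
      show "\<bar>c\<bar> / ?d x0 * ?d x = 0" if "x \<notin> closure G" for x
      proof -
        have "x \<in> - G" using that closure_subset[of G] by blast
        then show ?thesis by (simp add: infdist_zero)
      qed
      fix x assume "x \<in> K"
      then have "\<bar>c\<bar> * ?d x0 \<le> \<bar>c\<bar> * ?d x" using x0(2) by (intro mult_left_mono) auto
      then have "\<bar>c\<bar> \<le> \<bar>c\<bar> / ?d x0 * ?d x" using \<open>?d x0 > 0\<close> by (simp add: field_simps)
      then show "c \<le> \<bar>c\<bar> / ?d x0 * ?d x" by linarith
    qed
  qed
qed

lemma sets_borel_Collect_le:
  fixes f g :: "'a::topological_space \<Rightarrow> real"
  assumes "continuous_on UNIV f" "continuous_on UNIV g"
  shows "{x. f x \<le> g x} \<in> sets borel"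
  by (intro borel_closed closed_Collect_le assms)


section \<open>Energy measures of local Dirichlet forms\<close>

lemma suminf_suminf_commute_ennreal:
  fixes f :: "nat \<Rightarrow> nat \<Rightarrow> ennreal"
  shows "(\<Sum>i. \<Sum>j. f i j) = (\<Sum>j. \<Sum>i. f i j)"
  using nn_integral_suminf[of "\<lambda>j i. f i j" "count_space UNIV"]
  by (simp add: nn_integral_count_space_nat)

text \<open>
  The jump measure is zero: the form consists of a strongly local part and a killing part.
\<close>

locale local_dirichlet_form =
  fixes m :: "'a::{metric_space, second_countable_topology} measure"
    and D :: "('a \<Rightarrow> real) set"
    and \<E> :: "('a \<Rightarrow> real) \<Rightarrow> ('a \<Rightarrow> real) \<Rightarrow> real"
    and J :: "('a \<times> 'a) measure"
    and \<Gamma> :: "('a \<Rightarrow> real) \<Rightarrow> ('a \<Rightarrow> real) \<Rightarrow> 'a set \<Rightarrow> real"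
    and k :: "'a measure"
  assumes locally_compact: "locally compact (UNIV :: 'a set)"
    and radon: "radon_measure m"
    and regular: "regular_dirichlet_form m D \<E>"
    and beurling_deny: "beurling_deny m D \<E> J \<Gamma> k"
    and no_jumps: "\<forall>B\<in>sets J. emeasure J B = 0"
begin

abbreviation core :: "('a \<Rightarrow> real) set" where "core \<equiv> D \<inter> Cc_space"

lemma dirichlet: "dirichlet_form m D \<E>"
  using regular by (simp add: regular_dirichlet_form_def)

sublocale energy: nonneg_form D \<E>
  by (rule dirichlet_nonneg_form[OF dirichlet])

lemma sets_m: "sets m = sets borel" and space_m: "space m = UNIV"
  using radon_measure_sets[OF radon] sets_eq_imp_space_eq[of m borel] by auto

lemma continuous_measurable_m: "continuous_on UNIV u \<Longrightarrow> u \<in> borel_measurable m"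
  using borel_measurable_continuous_onI measurable_cong_sets[OF sets_m refl] by blast

lemma beurling_denyD:
  shows killing_radon: "radon_measure k"
    and Gamma_signed: "\<lbrakk>u \<in> D; v \<in> D\<rbrakk> \<Longrightarrow> signed_radon_measure (\<Gamma> u v)"
    and Gamma_bilinear: "B \<in> sets borel \<Longrightarrow> symmetric_bilinear_on D (\<lambda>u v. \<Gamma> u v B)"
    and Gamma_nonneg: "\<lbrakk>u \<in> D; B \<in> sets borel\<rbrakk> \<Longrightarrow> 0 \<le> \<Gamma> u u B"
    and Gamma_strongly_local: "strongly_local m D \<Gamma>"
    and energy_formula: "\<lbrakk>u \<in> D; quasi_continuous_rep m D \<E> u w\<rbrakk> \<Longrightarrow>
      ennreal (\<E> u u) = (\<integral>\<^sup>+ (x, y). ennreal ((w x - w y)\<^sup>2) \<partial>J)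
        + ennreal (\<Gamma> u u UNIV) + (\<integral>\<^sup>+ x. ennreal ((w x)\<^sup>2) \<partial>k)"
proof -
  note bd = beurling_deny[unfolded beurling_deny_def]
  note bd3 = bd[THEN conjunct2, THEN conjunct2, THEN conjunct2]
  note bd5 = bd3[THEN conjunct2, THEN conjunct2]
  show "radon_measure k" by (rule bd[THEN conjunct1])
  show "\<lbrakk>u \<in> D; v \<in> D\<rbrakk> \<Longrightarrow> signed_radon_measure (\<Gamma> u v)"
    by (rule bd3[THEN conjunct1, rule_format])
  show "B \<in> sets borel \<Longrightarrow> symmetric_bilinear_on D (\<lambda>u v. \<Gamma> u v B)"
    "\<lbrakk>u \<in> D; B \<in> sets borel\<rbrakk> \<Longrightarrow> 0 \<le> \<Gamma> u u B"
    using bd3[THEN conjunct2, THEN conjunct1] by simp_all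
  show "strongly_local m D \<Gamma>" by (rule bd5[THEN conjunct1])
  show "\<lbrakk>u \<in> D; quasi_continuous_rep m D \<E> u w\<rbrakk> \<Longrightarrow>
      ennreal (\<E> u u) = (\<integral>\<^sup>+ (x, y). ennreal ((w x - w y)\<^sup>2) \<partial>J)
        + ennreal (\<Gamma> u u UNIV) + (\<integral>\<^sup>+ x. ennreal ((w x)\<^sup>2) \<partial>k)"
    by (rule bd5[THEN conjunct2, rule_format])
qed

lemma m_compact: "compact K \<Longrightarrow> emeasure m K < \<infinity>"
  and k_compact: "compact K \<Longrightarrow> emeasure k K < \<infinity>"
  using radon killing_radon by (simp_all add: radon_measure_on_def)

lemma Gamma_form: "B \<in> sets borel \<Longrightarrow> nonneg_form D (\<lambda>u v. \<Gamma> u v B)"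
  using energy.lin Gamma_bilinear Gamma_nonneg by (simp add: nonneg_form_def)

lemma Gamma_local:
  assumes "u \<in> D" "v \<in> D" "relatively_compact_open G" "eq_ae_on m G u v" "B \<in> sets borel" "B \<subseteq> G"
  shows "\<Gamma> u u B = \<Gamma> v v B"
  using Gamma_strongly_local[unfolded strongly_local_def, THEN conjunct2] assms by blast

lemma Gamma_eq_0_of_const_on_support:
  assumes "u \<in> D" "v \<in> D" "eq_ae_on m (ae_support m v) u (\<lambda>_. c)" "B \<in> sets borel"
  shows "\<Gamma> u v B = 0"
  using Gamma_strongly_local[unfolded strongly_local_def, THEN conjunct1] assms by blast

lemma Gamma_measure:
  assumes "u \<in> D"
  obtains M where "sets M = sets borel" "finite_measure M"
    "\<And>B. B \<in> sets borel \<Longrightarrow> emeasure M B = ennreal (\<Gamma> u u B)"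
proof -
  have "signed_radon_measure (\<Gamma> u u)"
    by (rule Gamma_signed[OF assms assms])
  then obtain M N where MN: "radon_measure M" "radon_measure N" "finite_measure M" "finite_measure N"
    "\<And>B. B \<in> sets borel \<Longrightarrow> \<Gamma> u u B = measure M B - measure N B"
    unfolding signed_radon_measure_def by blast
  interpret M: finite_measure M by fact
  interpret N: finite_measure N by fact
  have sets: "sets M = sets borel" "sets N = sets borel"
    using radon_measure_sets MN(1,2) by blast+
  have le: "measure N B \<le> measure M B" if "B \<in> sets borel" for B
    using MN(5)[OF that] Gamma_nonneg[OF assms that] by simp
  have em: "emeasure (diff_measure M N) B = ennreal (\<Gamma> u u B)" if B: "B \<in> sets borel" for B
  proof -
    have "emeasure (diff_measure M N) B = emeasure M B - emeasure N B"
      using sets le B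
      by (intro emeasure_diff_measure)
        (auto simp: MN(3,4) M.emeasure_eq_measure N.emeasure_eq_measure intro!: ennreal_leI)
    also have "\<dots> = ennreal (\<Gamma> u u B)"
      using MN(5)[OF B] by (simp add: M.emeasure_eq_measure N.emeasure_eq_measure ennreal_minus)
    finally show ?thesis .
  qed
  have "finite_measure (diff_measure M N)"
  proof
    have "space M = UNIV" using sets_eq_imp_space_eq[OF sets(1)] by simp
    then show "emeasure (diff_measure M N) (space (diff_measure M N)) \<noteq> \<infinity>"
      using em[of UNIV] by simp
  qed
  then show thesis using that[of "diff_measure M N"] sets em by simp
qed

lemma Gamma_Un:
  assumes "u \<in> D" "A \<in> sets borel" "B \<in> sets borel" "A \<inter> B = {}"
  shows "\<Gamma> u u (A \<union> B) = \<Gamma> u u A + \<Gamma> u u B"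
proof -
  obtain M where M: "sets M = sets borel" "finite_measure M"
    "\<And>B. B \<in> sets borel \<Longrightarrow> emeasure M B = ennreal (\<Gamma> u u B)"
    using Gamma_measure[OF assms(1)] by blast
  interpret finite_measure M by fact
  have "measure M C = \<Gamma> u u C" if "C \<in> sets borel" for C
    using M(3)[OF that] Gamma_nonneg[OF assms(1) that] by (simp add: measure_def)
  then show ?thesis
    using finite_measure_Union[of A B] assms M(1) by simp
qed

lemma Gamma_mono:
  assumes "u \<in> D" "A \<in> sets borel" "B \<in> sets borel" "A \<subseteq> B"
  shows "\<Gamma> u u A \<le> \<Gamma> u u B"
proof -
  have "A \<union> (B - A) = B" using assms(4) by blast
  then show ?thesis
    using Gamma_Un[OF assms(1,2), of "B - A"] assms Gamma_nonneg[OF assms(1), of "B - A"] by auto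
qed

lemma Gamma_split:
  assumes "u \<in> D" "A \<in> sets borel" "B \<in> sets borel"
  shows "\<Gamma> u u B = \<Gamma> u u (B \<inter> A) + \<Gamma> u u (B - A)"
proof -
  have "(B \<inter> A) \<union> (B - A) = B" by blast
  then show ?thesis using Gamma_Un[OF assms(1), of "B \<inter> A" "B - A"] assms by auto
qed

lemma Gamma_zero: "B \<in> sets borel \<Longrightarrow> \<Gamma> (\<lambda>_. 0) (\<lambda>_. 0) B = 0"
  using nonneg_form.form_scale[OF Gamma_form dirichlet_zero[OF dirichlet], of B 0] by simp

text \<open>
  Locality compares \<open>u\<close> with the zero function on relatively compact open sets only, so the open
  set \<open>U\<close> is first cut into countably many such pieces.
\<close>

lemma Gamma_null_on_open:
  assumes u: "u \<in> D" and U: "open U" "\<And>x. x \<in> U \<Longrightarrow> u x = 0" and B: "B \<in> sets borel" "B \<subseteq> U"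
  shows "\<Gamma> u u B = 0"
proof -
  obtain M where M: "sets M = sets borel" "finite_measure M"
    "\<And>B. B \<in> sets borel \<Longrightarrow> emeasure M B = ennreal (\<Gamma> u u B)"
    using Gamma_measure[OF u] by blast
  obtain G :: "nat \<Rightarrow> 'a set" where G: "\<And>n. relatively_compact_open (G n)" "(\<Union>n. G n) = UNIV"
    using relatively_compact_exhaustion[OF locally_compact] by blast
  have op: "open (G n)" for n using G(1) by (simp add: relatively_compact_open_def)
  have "\<Gamma> u u (B \<inter> G n) = 0" for n
  proof -
    have rc: "relatively_compact_open (U \<inter> G n)"
      using relatively_compact_open_subset[OF G(1)[of n]] U(1) op by blast
    have "eq_ae_on m (U \<inter> G n) u (\<lambda>_. 0)" using U(2) by (auto simp: eq_ae_on_def)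
    from Gamma_local[OF u dirichlet_zero[OF dirichlet] rc this, of "B \<inter> G n"] B op
    have "\<Gamma> u u (B \<inter> G n) = \<Gamma> (\<lambda>_. 0) (\<lambda>_. 0) (B \<inter> G n)" by auto
    also have "\<dots> = 0" using B op by (intro Gamma_zero) auto
    finally show ?thesis .
  qed
  then have "emeasure M (\<Union>n. B \<inter> G n) = 0"
    using B op M by (intro emeasure_UN_eq_0) auto
  moreover have "(\<Union>n. B \<inter> G n) = B" using G(2) by blast
  ultimately show ?thesis
    using M(3)[OF B(1)] Gamma_nonneg[OF u B(1)] by (simp add: ennreal_eq_0_iff)
qed

lemma core_quasi_continuous:
  assumes "u \<in> D" "continuous_on UNIV u"
  shows "quasi_continuous_rep m D \<E> u u"
proof -
  have "form_E1 m \<E> (\<lambda>_. 0) = 0"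
    using energy.form_scale[OF dirichlet_zero[OF dirichlet], of 0] by (simp add: form_E1_def)
  then have "capacity m D \<E> {} \<le> ennreal 0"
    unfolding capacity_def using dirichlet_zero[OF dirichlet]
    by (intro INF_lower2[of "\<lambda>_. 0"]) auto
  then have "quasi_continuous m D \<E> u"
    unfolding quasi_continuous_def using assms(2) by (intro allI impI exI[of _ "{}"]) auto
  then show ?thesis
    using assms by (simp add: quasi_continuous_rep_def borel_measurable_continuous_onI)
qed

lemma AE_no_jumps: "AE z in J. P z"
  using no_jumps by (intro AE_I[of _ _ "space J"]) auto

lemma core_energy:
  assumes "u \<in> core"
  shows "ennreal (\<E> u u) = ennreal (\<Gamma> u u UNIV) + (\<integral>\<^sup>+ x. ennreal ((u x)\<^sup>2) \<partial>k)"
proof -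
  have "quasi_continuous_rep m D \<E> u u"
    using assms by (intro core_quasi_continuous) (auto simp: Cc_space_def)
  then have "ennreal (\<E> u u) = (\<integral>\<^sup>+ (x, y). ennreal ((u x - u y)\<^sup>2) \<partial>J)
      + ennreal (\<Gamma> u u UNIV) + (\<integral>\<^sup>+ x. ennreal ((u x)\<^sup>2) \<partial>k)"
    using energy_formula assms by blast
  moreover have "(\<integral>\<^sup>+ (x, y). ennreal ((u x - u y)\<^sup>2) \<partial>J) = (\<integral>\<^sup>+ z. 0 \<partial>J)"
    by (rule nn_integral_cong_AE[OF AE_no_jumps])
  ultimately show ?thesis by simp
qed

text \<open>
  Together with \<open>dirichlet_convex_approximation\<close> this turns approximation in energy into
  approximation of the energy measure on every Borel set.
\<close>

lemma Gamma_le_energy: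
  assumes "u \<in> core" "B \<in> sets borel"
  shows "\<Gamma> u u B \<le> \<E> u u"
proof -
  have "ennreal (\<Gamma> u u UNIV) \<le> ennreal (\<E> u u)"
    using core_energy[OF assms(1)] by simp
  then have "\<Gamma> u u UNIV \<le> \<E> u u"
    using energy.nonneg assms by (simp add: ennreal_le_iff)
  then show ?thesis using Gamma_mono[of u B UNIV] assms by simp
qed


subsection \<open>Functions in the form domain with compact support\<close>

lemma coreI:
  assumes "u \<in> D" "continuous_on UNIV u" "compact K" "\<And>x. x \<notin> K \<Longrightarrow> u x = 0"
  shows "u \<in> core"
  using assms Cc_spaceI by blast

lemma coreD: "u \<in> core \<Longrightarrow> u \<in> D" "u \<in> core \<Longrightarrow> continuous_on UNIV u"
  by (simp_all add: Cc_space_def)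

lemma core_lincomb:
  assumes "u \<in> core" "v \<in> core"
  shows "(\<lambda>x. a * u x + b * v x) \<in> core"
proof -
  obtain K L where K: "compact K" "\<And>x. x \<notin> K \<Longrightarrow> u x = 0"
    and L: "compact L" "\<And>x. x \<notin> L \<Longrightarrow> v x = 0"
    using Cc_space_support assms by (metis IntD2)
  show ?thesis
  proof (rule coreI)
    show "(\<lambda>x. a * u x + b * v x) \<in> D" using energy.lin coreD assms by blast
    show "continuous_on UNIV (\<lambda>x. a * u x + b * v x)"
      using coreD(2) assms by (intro continuous_intros) auto
    show "compact (K \<union> L)" using K(1) L(1) by blast
    show "\<And>x. x \<notin> K \<union> L \<Longrightarrow> a * u x + b * v x = 0" using K(2) L(2) by simp
  qed
qed

lemma core_add: "u \<in> core \<Longrightarrow> v \<in> core \<Longrightarrow> (\<lambda>x. u x + v x) \<in> core"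
  using core_lincomb[of u v 1 1] by simp

lemma core_diff: "u \<in> core \<Longrightarrow> v \<in> core \<Longrightarrow> (\<lambda>x. u x - v x) \<in> core"
  using core_lincomb[of u v 1 "-1"] by simp

lemma core_scale: "u \<in> core \<Longrightarrow> (\<lambda>x. a * u x) \<in> core"
  using core_lincomb[of u u a 0] by simp

lemma core_contraction:
  assumes T: "normal_contraction T" and u: "u \<in> core"
  shows "(\<lambda>x. T (u x)) \<in> core" "\<E> (\<lambda>x. T (u x)) (\<lambda>x. T (u x)) \<le> \<E> u u"
proof -
  have D: "T \<circ> u \<in> D" and le: "\<E> (T \<circ> u) (T \<circ> u) \<le> \<E> u u"
    using dirichlet_contraction[OF dirichlet T coreD(1)[OF u]] by auto
  obtain K where K: "compact K" "\<And>x. x \<notin> K \<Longrightarrow> u x = 0"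
    using Cc_space_support u by (metis IntD2)
  have lip: "\<bar>T s - T t\<bar> \<le> \<bar>s - t\<bar>" and T0: "T 0 = 0" for s t
    using T by (auto simp: normal_contraction_def)
  have "continuous_on UNIV T"
  proof (subst continuous_on_iff, intro ballI allI impI)
    fix s e :: real assume "0 < e"
    then show "\<exists>d>0. \<forall>t\<in>UNIV. dist t s < d \<longrightarrow> dist (T t) (T s) < e"
      using lip by (intro exI[of _ e]) (auto simp: dist_real_def intro: le_less_trans)
  qed
  then have "continuous_on UNIV (T \<circ> u)"
    using continuous_on_compose[OF coreD(2)[OF u]] continuous_on_subset by blast
  then have "T \<circ> u \<in> core"
    using D K T0 by (intro coreI[of _ K]) auto
  then show "(\<lambda>x. T (u x)) \<in> core" "\<E> (\<lambda>x. T (u x)) (\<lambda>x. T (u x)) \<le> \<E> u u"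
    using le by (simp_all add: comp_def)
qed

lemma D_min:
  assumes "u \<in> D" "v \<in> D"
  shows "(\<lambda>x. min (u x) (v x)) \<in> D"
proof -
  have "normal_contraction abs" by (auto simp: normal_contraction_def)
  then have "abs \<circ> (\<lambda>x. u x - v x) \<in> D"
    using dirichlet_contraction[OF dirichlet] energy.diff_mem[OF assms] by blast
  from energy.lin[OF energy.add_mem[OF assms] this, of "1/2" "-1/2"]
  have "(\<lambda>x. 1/2 * (u x + v x) + - 1/2 * \<bar>u x - v x\<bar>) \<in> D" by (simp add: comp_def)
  moreover have "1/2 * (u x + v x) + - 1/2 * \<bar>u x - v x\<bar> = min (u x) (v x)" for x
    by (simp add: min_def abs_if field_simps)
  ultimately show ?thesis by simp
qed

lemma D_max:
  assumes "u \<in> D" "v \<in> D"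
  shows "(\<lambda>x. max (u x) (v x)) \<in> D"
proof -
  have "(\<lambda>x. - 1 * min (- 1 * u x) (- 1 * v x)) \<in> D"
    using assms by (intro energy.scale_mem D_min)
  moreover have "- 1 * min (- 1 * u x) (- 1 * v x) = max (u x) (v x)" for x
    by (simp add: min_def max_def)
  ultimately show ?thesis by simp
qed

lemma core_min:
  assumes "u \<in> core" "v \<in> core"
  shows "(\<lambda>x. min (u x) (v x)) \<in> core"
proof -
  obtain K L where K: "compact K" "\<And>x. x \<notin> K \<Longrightarrow> u x = 0"
    and L: "compact L" "\<And>x. x \<notin> L \<Longrightarrow> v x = 0"
    using Cc_space_support assms by (metis IntD2)
  show ?thesis
  proof (rule coreI)
    show "(\<lambda>x. min (u x) (v x)) \<in> D" using D_min coreD assms by blast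
    show "continuous_on UNIV (\<lambda>x. min (u x) (v x))"
      using coreD(2) assms by (intro continuous_intros) auto
    show "compact (K \<union> L)" using K(1) L(1) by blast
    show "\<And>x. x \<notin> K \<union> L \<Longrightarrow> min (u x) (v x) = 0" using K(2) L(2) by simp
  qed
qed

lemma L2_norm_le_of_compact_support:
  assumes "compact S" and u: "continuous_on UNIV u" and le: "\<And>x. \<bar>u x\<bar> \<le> \<delta>"
    and zero: "\<And>x. x \<notin> S \<Longrightarrow> u x = 0"
  shows "u \<in> L2_space m" "(\<integral>x. (u x)\<^sup>2 \<partial>m) \<le> \<delta>\<^sup>2 * measure m S"
proof -
  have S: "S \<in> sets m" using assms(1) sets_m by (simp add: borel_compact)
  have [measurable]: "u \<in> borel_measurable m" by (rule continuous_measurable_m[OF u])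
  have int: "integrable m (\<lambda>x. \<delta>\<^sup>2 * indicator S x :: real)"
    using S m_compact[OF assms(1)] by simp
  have bound: "(u x)\<^sup>2 \<le> \<delta>\<^sup>2 * indicator S x" for x
    using zero[of x] abs_le_square_iff[of "u x" \<delta>] le[of x] by (auto simp: indicator_def)
  have "integrable m (\<lambda>x. (u x)\<^sup>2)"
    by (rule Bochner_Integration.integrable_bound[OF int]) (use bound in auto)
  then show "u \<in> L2_space m" by (simp add: L2_space_def)
  have "(\<integral>x. (u x)\<^sup>2 \<partial>m) \<le> (\<integral>x. \<delta>\<^sup>2 * indicator S x \<partial>m)"
    by (rule integral_mono[OF \<open>integrable m (\<lambda>x. (u x)\<^sup>2)\<close> int bound])
  also have "\<dots> = \<delta>\<^sup>2 * measure m S" using S space_m by simp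
  finally show "(\<integral>x. (u x)\<^sup>2 \<partial>m) \<le> \<delta>\<^sup>2 * measure m S" .
qed

text \<open>
  Shrinking \<open>u\<close> towards zero by \<open>\<delta>\<close> gives a function that vanishes on the open set
  \<open>{\<bar>u\<bar> < \<delta>}\<close>, hence has no energy on \<open>{u = 0}\<close> by locality.  Its energy is at most that of \<open>u\<close>,
  and it is uniformly close to \<open>u\<close>, hence close in \<open>L\<^sup>2\<close> because the support is compact.
  The functions without energy on \<open>{u = 0}\<close> form a convex set,
  so \<open>u\<close> is a limit in energy of such functions.
\<close>

lemma Gamma_zero_set:
  assumes u: "u \<in> core"
  shows "\<Gamma> u u {x. u x = 0} = 0"
proof -
  let ?Z = "{x. u x = 0}"
  have Z: "?Z \<in> sets borel"
    using continuous_closed_preimage_constant[OF coreD(2)[OF u] closed_UNIV, of 0]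
    by (simp add: borel_closed)
  interpret G: nonneg_form D "\<lambda>u v. \<Gamma> u v ?Z" by (rule Gamma_form[OF Z])
  define P where "P = {w\<in>core. \<Gamma> w w ?Z \<le> 0}"
  have PD: "P \<subseteq> D" by (auto simp: P_def)
  have mid: "(\<lambda>x. (w x + w' x) / 2) \<in> P" if "w \<in> P" "w' \<in> P" for w w'
    using that core_lincomb[of w w' "1/2" "1/2"] G.form_midpoint_le[of w w' 0]
    by (simp add: P_def add_divide_distrib)
  have uL2: "u \<in> L2_space m" using dirichlet_L2[OF dirichlet] u by blast
  obtain S where S: "compact S" "\<And>x. x \<notin> S \<Longrightarrow> u x = 0"
    using Cc_space_support u by (metis IntD2)
  have approx: "\<exists>w\<in>P. \<E> w w \<le> \<E> u u \<and> (\<integral>x. (w x - u x)\<^sup>2 \<partial>m) \<le> \<epsilon>" if eps: "0 < \<epsilon>" for \<epsilon>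
  proof -
    obtain \<delta> where \<delta>: "0 < \<delta>" "\<delta>\<^sup>2 * measure m S \<le> \<epsilon>"
      using ex_small_square[OF eps, of "measure m S"] by auto
    \<comment> \<open>Soft thresholding: the distance to \<open>[-\<delta>,\<delta>]\<close> with the sign of the argument.\<close>
    define T :: "real \<Rightarrow> real" where "T s = s - max (- \<delta>) (min s \<delta>)" for s
    have T: "normal_contraction T"
      using \<delta>(1) by (auto simp: normal_contraction_def T_def max_def min_def)
    let ?w = "\<lambda>x. T (u x)"
    note w = core_contraction[OF T u]
    have "open {x. \<bar>u x\<bar> < \<delta>}"
      using coreD(2)[OF u] by (intro open_Collect_less continuous_intros)
    then have "\<Gamma> ?w ?w ?Z = 0"
      using \<delta>(1) w(1) Z
      by (intro Gamma_null_on_open[of ?w "{x. \<bar>u x\<bar> < \<delta>}"]) (auto simp: T_def)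
    then have "?w \<in> P" using w(1) by (simp add: P_def)
    moreover have "\<bar>?w x - u x\<bar> \<le> \<delta>" and "x \<notin> S \<Longrightarrow> ?w x - u x = 0" for x
      using \<delta>(1) S(2)[of x] by (auto simp: T_def max_def min_def)
    then have "(\<integral>x. (?w x - u x)\<^sup>2 \<partial>m) \<le> \<delta>\<^sup>2 * measure m S"
      using coreD(2)[OF w(1)] coreD(2)[OF u]
      by (intro L2_norm_le_of_compact_support S(1) continuous_intros) auto
    ultimately show ?thesis using w(2) \<delta>(2) by (intro bexI[of _ ?w]) auto
  qed
  have "\<Gamma> u u ?Z \<le> 0"
  proof (rule G.form_le_of_approx[OF coreD(1)[OF u]])
    fix \<epsilon> :: real assume "0 < \<epsilon>"
    from dirichlet_convex_approximation(2)[OF dirichlet PD mid uL2 approx this]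
    obtain w where w: "w \<in> P" "\<E> (\<lambda>x. w x - u x) (\<lambda>x. w x - u x) < \<epsilon>" by blast
    then have "w \<in> core" by (simp add: P_def)
    from Gamma_le_energy[OF core_diff[OF this u] Z] w
    show "\<exists>w\<in>D. \<Gamma> w w ?Z \<le> 0 \<and> \<Gamma> (\<lambda>x. w x - u x) (\<lambda>x. w x - u x) ?Z < \<epsilon>"
      by (intro bexI[of _ w]) (auto simp: P_def)
  qed
  then show ?thesis using Gamma_nonneg[OF coreD(1)[OF u] Z] by simp
qed

lemma Gamma_eq_0:
  assumes u: "u \<in> core" and B: "B \<in> sets borel" "\<And>x. x \<in> B \<Longrightarrow> u x = 0"
  shows "\<Gamma> u u B = 0"
proof -
  have Z: "{x. u x = 0} \<in> sets borel"
    using continuous_closed_preimage_constant[OF coreD(2)[OF u] closed_UNIV, of 0]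
    by (simp add: borel_closed)
  have "\<Gamma> u u B \<le> \<Gamma> u u {x. u x = 0}"
    using B by (intro Gamma_mono[OF coreD(1)[OF u] B(1) Z]) auto
  then show ?thesis
    using Gamma_zero_set[OF u] Gamma_nonneg[OF coreD(1)[OF u] B(1)] by simp
qed

text \<open>
  Locality on arbitrary Borel sets: the difference of the two functions has no energy on its zero
  set.  The truncation property is a consequence.
\<close>

lemma Gamma_eq_on:
  assumes u: "u \<in> core" and v: "v \<in> core" and B: "B \<in> sets borel" "\<And>x. x \<in> B \<Longrightarrow> u x = v x"
  shows "\<Gamma> u u B = \<Gamma> v v B"
proof -
  interpret G: nonneg_form D "\<lambda>u v. \<Gamma> u v B" by (rule Gamma_form[OF B(1)])
  have "\<Gamma> (\<lambda>x. v x - u x) (\<lambda>x. v x - u x) B = 0"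
    using Gamma_eq_0[OF core_diff[OF v u] B(1)] B(2) by simp
  from G.form_add_null[OF coreD(1)[OF u] energy.diff_mem[OF coreD(1)[OF v] coreD(1)[OF u]] this]
  show ?thesis by simp
qed

lemma ex_cutoff:
  assumes "compact K"
  obtains \<phi> where "\<phi> \<in> core" "\<And>x. 0 \<le> \<phi> x" "\<And>x. \<phi> x \<le> 1" "\<And>x. x \<in> K \<Longrightarrow> \<phi> x = 1"
proof -
  obtain f :: "'a \<Rightarrow> real" where f: "f \<in> Cc_space" "\<And>x. x \<in> K \<Longrightarrow> 2 \<le> f x"
    using ex_Cc_space_ge_on_compact[OF locally_compact assms, of 2] by blast
  obtain v where v: "v \<in> core" "\<And>x. \<bar>f x - v x\<bar> < 1"
    using regular[unfolded regular_dirichlet_form_def, THEN conjunct2, THEN conjunct2,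
        rule_format, OF f(1), of 1] by auto
  have T: "normal_contraction (\<lambda>s. max 0 (min s 1))"
    by (auto simp: normal_contraction_def max_def min_def)
  show thesis
  proof
    show "(\<lambda>x. max 0 (min (v x) 1)) \<in> core" by (rule core_contraction(1)[OF T v(1)])
    show "max 0 (min (v x) 1) = 1" if "x \<in> K" for x
      using f(2)[OF that] v(2)[of x] by (simp add: abs_if split: if_splits)
  qed auto
qed

text \<open>
  Take a second function \<open>\<psi>\<close> that is one on the support of \<open>\<phi>\<close>.  Strong locality makes the mixed
  term of \<open>\<psi>\<close> and \<open>\<phi>\<close> vanish, while \<open>\<psi> - \<phi>\<close> is zero on \<open>B\<close> and has no energy there.  So the
  energies of \<open>\<psi>\<close> and \<open>\<phi>\<close> on \<open>B\<close>, both non-negative, add up to zero.  In effect constants have no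
  energy.
\<close>

lemma Gamma_cutoff:
  assumes \<phi>: "\<phi> \<in> core" and B: "B \<in> sets borel" "\<And>x. x \<in> B \<Longrightarrow> \<phi> x = 1"
  shows "\<Gamma> \<phi> \<phi> B = 0"
proof -
  interpret G: nonneg_form D "\<lambda>u v. \<Gamma> u v B" by (rule Gamma_form[OF B(1)])
  obtain S where S: "compact S" "closed S" "\<And>x. x \<notin> S \<Longrightarrow> \<phi> x = 0"
    using Cc_space_support[of \<phi>] \<phi> by auto
  obtain \<psi> where \<psi>: "\<psi> \<in> core" "\<And>x. x \<in> S \<Longrightarrow> \<psi> x = 1"
    using ex_cutoff[OF S(1)] by metis
  have "- S \<in> {U. open U \<and> eq_ae_on m U \<phi> (\<lambda>_. 0)}"
    using S by (auto simp: eq_ae_on_def)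
  then have "ae_support m \<phi> \<subseteq> S" unfolding ae_support_def by blast
  then have "eq_ae_on m (ae_support m \<phi>) \<psi> (\<lambda>_. 1)"
    using \<psi>(2) by (auto simp: eq_ae_on_def)
  then have cross: "\<Gamma> \<psi> \<phi> B = 0"
    using Gamma_eq_0_of_const_on_support[OF coreD(1)[OF \<psi>(1)] coreD(1)[OF \<phi>] _ B(1)] by blast
  have "\<psi> x - \<phi> x = 0" if "x \<in> B" for x
    using B(2)[OF that] S(3)[of x] \<psi>(2)[of x] by (cases "x \<in> S") auto
  then have "\<Gamma> (\<lambda>x. \<psi> x - \<phi> x) (\<lambda>x. \<psi> x - \<phi> x) B = 0"
    using Gamma_eq_0[OF core_diff[OF \<psi>(1) \<phi>] B(1)] by blast
  then have "\<Gamma> \<psi> \<psi> B + \<Gamma> \<phi> \<phi> B = 0"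
    using G.form_diff[OF coreD(1)[OF \<psi>(1)] coreD(1)[OF \<phi>]] cross by simp
  then show ?thesis
    using Gamma_nonneg[OF coreD(1)[OF \<psi>(1)] B(1)] Gamma_nonneg[OF coreD(1)[OF \<phi>] B(1)] by simp
qed


section \<open>Functions of energy density at most one\<close>

text \<open>
  The bound by \<open>m\<close> is expressed through local representatives that are continuous and compactly
  supported, which avoids the measure \<open>\<mu>\<^sup>(\<^sup>c\<^sup>)(u)\<close> on the local space.  That the two
  descriptions agree is shown below in \<open>subunit_iff_mu_c_le\<close>.
\<close>

definition subunit :: "('a \<Rightarrow> real) set" where
  "subunit = {u. continuous_on UNIV u \<and> (\<forall>G. relatively_compact_open G \<longrightarrow>
     (\<exists>v\<in>core. (\<forall>x\<in>G. v x = u x) \<and> (\<forall>B\<in>sets borel. B \<subseteq> G \<longrightarrow> \<Gamma> v v B \<le> measure m B)))}"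

lemma subunitI:
  assumes "continuous_on UNIV u"
    and "\<And>G. relatively_compact_open G \<Longrightarrow> \<exists>v\<in>core. (\<forall>x\<in>G. v x = u x) \<and>
      (\<forall>B\<in>sets borel. B \<subseteq> G \<longrightarrow> \<Gamma> v v B \<le> measure m B)"
  shows "u \<in> subunit"
  using assms by (simp add: subunit_def)

lemma subunit_continuous: "u \<in> subunit \<Longrightarrow> continuous_on UNIV u"
  by (simp add: subunit_def)

lemma subunit_localize:
  assumes "u \<in> subunit" "relatively_compact_open G"
  obtains v where "v \<in> core" "\<And>x. x \<in> G \<Longrightarrow> v x = u x"
    "\<And>B. B \<in> sets borel \<Longrightarrow> B \<subseteq> G \<Longrightarrow> \<Gamma> v v B \<le> measure m B"
proof -
  have "\<exists>v\<in>core. (\<forall>x\<in>G. v x = u x) \<and> (\<forall>B\<in>sets borel. B \<subseteq> G \<longrightarrow> \<Gamma> v v B \<le> measure m B)"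
    using assms by (simp add: subunit_def)
  then obtain v where v: "v \<in> core"
    "(\<forall>x\<in>G. v x = u x) \<and> (\<forall>B\<in>sets borel. B \<subseteq> G \<longrightarrow> \<Gamma> v v B \<le> measure m B)" ..
  show thesis by (rule that[OF v(1)]) (use v(2) in auto)
qed

lemma emeasure_m_finite:
  assumes "relatively_compact_open G" "B \<subseteq> G"
  shows "emeasure m B \<noteq> \<infinity>"
proof -
  have "compact (closure G)" using assms by (simp add: relatively_compact_open_def)
  moreover have "B \<subseteq> closure G" using assms(2) closure_subset by blast
  ultimately have "emeasure m B \<le> emeasure m (closure G)"
    using sets_m by (intro emeasure_mono) (auto simp: borel_compact)
  then show ?thesis using m_compact[OF \<open>compact (closure G)\<close>] by (auto simp: top_unique)
qed

lemma measure_m_split: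
  assumes "relatively_compact_open G" "B \<subseteq> G" "A \<in> sets borel" "B \<in> sets borel"
  shows "measure m B = measure m (B \<inter> A) + measure m (B - A)"
proof -
  have "B \<inter> A \<subseteq> G" "B - A \<subseteq> G" using assms(2) by auto
  from emeasure_m_finite[OF assms(1) this(1)] emeasure_m_finite[OF assms(1) this(2)]
  have "measure m ((B \<inter> A) \<union> (B - A)) = measure m (B \<inter> A) + measure m (B - A)"
    using assms(3,4) sets_m by (intro measure_Union) auto
  moreover have "(B \<inter> A) \<union> (B - A) = B" by blast
  ultimately show ?thesis by simp
qed

lemma subunit_min:
  assumes u: "u1 \<in> subunit" "u2 \<in> subunit"
  shows "(\<lambda>x. min (u1 x) (u2 x)) \<in> subunit"
proof (rule subunitI)
  show "continuous_on UNIV (\<lambda>x. min (u1 x) (u2 x))"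
    using subunit_continuous u by (intro continuous_intros) auto
  fix G :: "'a set" assume G: "relatively_compact_open G"
  obtain f where f: "f \<in> core" "\<And>x. x \<in> G \<Longrightarrow> f x = u1 x"
    "\<And>B. B \<in> sets borel \<Longrightarrow> B \<subseteq> G \<Longrightarrow> \<Gamma> f f B \<le> measure m B"
    using subunit_localize[OF u(1) G] by metis
  obtain g where g: "g \<in> core" "\<And>x. x \<in> G \<Longrightarrow> g x = u2 x"
    "\<And>B. B \<in> sets borel \<Longrightarrow> B \<subseteq> G \<Longrightarrow> \<Gamma> g g B \<le> measure m B"
    using subunit_localize[OF u(2) G] by metis
  let ?w = "\<lambda>x. min (f x) (g x)" and ?A = "{x. f x \<le> g x}"
  have w: "?w \<in> core" by (rule core_min[OF f(1) g(1)])
  have A: "?A \<in> sets borel"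
    by (rule sets_borel_Collect_le[OF coreD(2)[OF f(1)] coreD(2)[OF g(1)]])
  have "\<Gamma> ?w ?w B \<le> measure m B" if B: "B \<in> sets borel" "B \<subseteq> G" for B
  proof -
    have BA: "B \<inter> ?A \<in> sets borel" "B - ?A \<in> sets borel" using A B by auto
    have "\<Gamma> ?w ?w B = \<Gamma> ?w ?w (B \<inter> ?A) + \<Gamma> ?w ?w (B - ?A)"
      by (rule Gamma_split[OF coreD(1)[OF w] A B(1)])
    also have "\<Gamma> ?w ?w (B \<inter> ?A) = \<Gamma> f f (B \<inter> ?A)"
      by (rule Gamma_eq_on[OF w f(1) BA(1)]) simp
    also have "\<Gamma> ?w ?w (B - ?A) = \<Gamma> g g (B - ?A)"
      by (rule Gamma_eq_on[OF w g(1) BA(2)]) simp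
    also have "\<Gamma> f f (B \<inter> ?A) + \<Gamma> g g (B - ?A) \<le> measure m (B \<inter> ?A) + measure m (B - ?A)"
      using BA B by (intro add_mono f(3) g(3)) auto
    also have "\<dots> = measure m B"
      by (rule measure_m_split[OF G B(2) A B(1), symmetric])
    finally show ?thesis .
  qed
  then show "\<exists>v\<in>core. (\<forall>x\<in>G. v x = min (u1 x) (u2 x)) \<and>
      (\<forall>B\<in>sets borel. B \<subseteq> G \<longrightarrow> \<Gamma> v v B \<le> measure m B)"
    using w f(2) g(2) by (intro bexI[OF _ w]) auto
qed

lemma subunit_uminus:
  assumes u: "u \<in> subunit"
  shows "(\<lambda>x. - u x) \<in> subunit"
proof (rule subunitI)
  show "continuous_on UNIV (\<lambda>x. - u x)"
    using subunit_continuous u by (intro continuous_intros) auto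
  fix G :: "'a set" assume G: "relatively_compact_open G"
  obtain f where f: "f \<in> core" "\<And>x. x \<in> G \<Longrightarrow> f x = u x"
    "\<And>B. B \<in> sets borel \<Longrightarrow> B \<subseteq> G \<Longrightarrow> \<Gamma> f f B \<le> measure m B"
    using subunit_localize[OF u G] by metis
  have "\<Gamma> (\<lambda>x. - 1 * f x) (\<lambda>x. - 1 * f x) B = \<Gamma> f f B" if "B \<in> sets borel" for B
    using nonneg_form.form_scale[OF Gamma_form[OF that] coreD(1)[OF f(1)], of "-1"] by simp
  then show "\<exists>v\<in>core. (\<forall>x\<in>G. v x = - u x) \<and>
      (\<forall>B\<in>sets borel. B \<subseteq> G \<longrightarrow> \<Gamma> v v B \<le> measure m B)"
    using f(2,3) by (intro bexI[OF _ core_scale[OF f(1), of "- 1"]]) auto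
qed

lemma subunit_max:
  assumes "u1 \<in> subunit" "u2 \<in> subunit"
  shows "(\<lambda>x. max (u1 x) (u2 x)) \<in> subunit"
proof -
  have "(\<lambda>x. max (u1 x) (u2 x)) = (\<lambda>x. - min (- u1 x) (- u2 x))"
    by (auto simp: max_def min_def)
  then show ?thesis
    using subunit_uminus[OF subunit_min[OF subunit_uminus subunit_uminus, OF assms]] by simp
qed

lemma subunit_add_const:
  assumes u: "u \<in> subunit"
  shows "(\<lambda>x. u x + c) \<in> subunit"
proof (rule subunitI)
  show "continuous_on UNIV (\<lambda>x. u x + c)"
    using subunit_continuous u by (intro continuous_intros) auto
  fix G :: "'a set" assume G: "relatively_compact_open G"
  obtain f where f: "f \<in> core" "\<And>x. x \<in> G \<Longrightarrow> f x = u x"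
    "\<And>B. B \<in> sets borel \<Longrightarrow> B \<subseteq> G \<Longrightarrow> \<Gamma> f f B \<le> measure m B"
    using subunit_localize[OF u G] by metis
  obtain \<phi> where \<phi>: "\<phi> \<in> core" "\<And>x. x \<in> closure G \<Longrightarrow> \<phi> x = 1"
    using ex_cutoff[of "closure G"] G unfolding relatively_compact_open_def by metis
  have one: "\<phi> x = 1" if "x \<in> G" for x using \<phi>(2) that closure_subset by blast
  have c\<phi>: "(\<lambda>x. c * \<phi> x) \<in> core" by (rule core_scale[OF \<phi>(1)])
  let ?v = "\<lambda>x. f x + c * \<phi> x"
  have "\<Gamma> ?v ?v B \<le> measure m B" if B: "B \<in> sets borel" "B \<subseteq> G" for B
  proof -
    interpret G: nonneg_form D "\<lambda>u v. \<Gamma> u v B" by (rule Gamma_form[OF B(1)])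
    have "\<Gamma> \<phi> \<phi> B = 0" using Gamma_cutoff[OF \<phi>(1) B(1)] one B(2) by blast
    then have "\<Gamma> (\<lambda>x. c * \<phi> x) (\<lambda>x. c * \<phi> x) B = 0"
      using G.form_scale[OF coreD(1)[OF \<phi>(1)], of c] by simp
    from G.form_add_null[OF coreD(1)[OF f(1)] coreD(1)[OF c\<phi>] this] f(3)[OF B]
    show ?thesis by simp
  qed
  then show "\<exists>v\<in>core. (\<forall>x\<in>G. v x = u x + c) \<and>
      (\<forall>B\<in>sets borel. B \<subseteq> G \<longrightarrow> \<Gamma> v v B \<le> measure m B)"
    using f(2) one by (intro bexI[OF _ core_add[OF f(1) c\<phi>]]) auto
qed

lemma subunit_const: "(\<lambda>_. c) \<in> subunit"
proof -
  have "(\<lambda>_. 0) \<in> core"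
    by (rule coreI[OF dirichlet_zero[OF dirichlet], of "{}"]) auto
  then have "(\<lambda>_. 0) \<in> subunit"
    using Gamma_zero by (intro subunitI) (auto intro!: bexI[of _ "\<lambda>_. 0"])
  from subunit_add_const[OF this, of c] show ?thesis by simp
qed

lemma subunit_clamp:
  assumes "u \<in> subunit"
  shows "(\<lambda>x. max 0 (min (u x) T)) \<in> subunit"
  by (intro subunit_max subunit_min subunit_const assms)

text \<open>
  On \<open>G\<close> the function \<open>h\<close> agrees with \<open>min h (T\<phi>)\<close>, where \<open>\<phi>\<close> is a cutoff function that is one
  on \<open>G\<close>.  If \<open>u\<close> is subunit and close to \<open>h\<close> on the support \<open>S\<close> of \<open>\<phi>\<close>, then \<open>min u (T\<phi>)\<close>
  belongs to the domain.  It has energy at most \<open>m(S)\<close> plus the energy of \<open>T\<phi>\<close> plus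
  \<open>T\<^sup>2 k(S)\<close>, a bound independent of \<open>u\<close>.  The bound by \<open>m\<close> on the Borel subsets of \<open>G\<close> is a
  convex condition, so it passes to the limit.
\<close>

lemma subunit_locally_uniform_limit:
  assumes h: "continuous_on UNIV h" "\<And>x. 0 \<le> h x" "\<And>x. h x \<le> T"
    and approx: "\<And>K \<epsilon>. compact K \<Longrightarrow> 0 < \<epsilon> \<Longrightarrow>
      \<exists>u\<in>subunit. (\<forall>x. 0 \<le> u x \<and> u x \<le> T) \<and> (\<forall>x\<in>K. \<bar>u x - h x\<bar> \<le> \<epsilon>)"
  shows "h \<in> subunit"
proof (rule subunitI[OF h(1)])
  fix G :: "'a set" assume G: "relatively_compact_open G"
  have T: "0 \<le> T" using h(2,3) order_trans by blast
  obtain \<phi> where \<phi>: "\<phi> \<in> core" "\<And>x. 0 \<le> \<phi> x" "\<And>x. \<phi> x \<le> 1" "\<And>x. x \<in> closure G \<Longrightarrow> \<phi> x = 1"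
    using ex_cutoff[of "closure G"] G unfolding relatively_compact_open_def by metis
  have one: "\<phi> x = 1" if "x \<in> G" for x using \<phi>(4) that closure_subset by blast
  obtain S where S: "compact S" "closed S" "\<And>x. x \<notin> S \<Longrightarrow> \<phi> x = 0"
    using Cc_space_support[of \<phi>] \<phi>(1) by auto
  obtain G' where G': "relatively_compact_open G'" "S \<subseteq> G'"
    using locally_compact_compact_nhd[OF locally_compact S(1)] by blast
  have SB: "S \<in> sets borel" using S(2) by simp
  have T\<phi>: "(\<lambda>x. T * \<phi> x) \<in> core" by (rule core_scale[OF \<phi>(1)])
  have cont_T\<phi>: "continuous_on UNIV (\<lambda>x. T * \<phi> x)" by (rule coreD(2)[OF T\<phi>])
  have T\<phi>_bounds: "0 \<le> T * \<phi> x" "T * \<phi> x \<le> T" for x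
    using T \<phi>(2,3)[of x] mult_left_mono[of "\<phi> x" 1 T] by auto
  let ?v = "\<lambda>x. min (h x) (T * \<phi> x)"
  have v_cont: "continuous_on UNIV ?v" by (intro continuous_intros h(1) cont_T\<phi>)
  have v_off: "?v x = 0" if "x \<notin> S" for x using S(3)[OF that] h(2)[of x] by simp
  have v_bound: "\<bar>?v x\<bar> \<le> T" for x using h(2,3)[of x] T\<phi>_bounds[of x] by auto
  define P where "P = {w\<in>core. \<forall>B\<in>sets borel. B \<subseteq> G \<longrightarrow> \<Gamma> w w B \<le> measure m B}"
  have PD: "P \<subseteq> D" by (auto simp: P_def)
  have mid: "(\<lambda>x. (w x + w' x) / 2) \<in> P" if "w \<in> P" "w' \<in> P" for w w'
  proof -
    have "(\<lambda>x. (w x + w' x) / 2) \<in> core"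
      using that core_lincomb[of w w' "1/2" "1/2"] by (simp add: P_def add_divide_distrib)
    moreover have "\<Gamma> (\<lambda>x. (w x + w' x) / 2) (\<lambda>x. (w x + w' x) / 2) B \<le> measure m B"
      if "B \<in> sets borel" "B \<subseteq> G" for B
      using that \<open>w \<in> P\<close> \<open>w' \<in> P\<close>
      by (intro nonneg_form.form_midpoint_le[OF Gamma_form]) (auto simp: P_def)
    ultimately show ?thesis by (simp add: P_def)
  qed
  define C where "C = measure m S + T\<^sup>2 * \<Gamma> \<phi> \<phi> UNIV + T\<^sup>2 * measure k S"
  have app: "\<exists>w\<in>P. \<E> w w \<le> C \<and> (\<integral>x. (w x - ?v x)\<^sup>2 \<partial>m) \<le> \<epsilon>" if eps: "0 < \<epsilon>" for \<epsilon>
  proof -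
    obtain \<delta> where \<delta>: "0 < \<delta>" "\<delta>\<^sup>2 * measure m S \<le> \<epsilon>"
      using ex_small_square[OF eps, of "measure m S"] by auto
    obtain u where u: "u \<in> subunit" "\<And>x. 0 \<le> u x" "\<And>x. u x \<le> T"
      "\<And>x. x \<in> S \<Longrightarrow> \<bar>u x - h x\<bar> \<le> \<delta>"
      using approx[OF S(1) \<delta>(1)] by blast
    obtain f where f: "f \<in> core" "\<And>x. x \<in> G' \<Longrightarrow> f x = u x"
      "\<And>B. B \<in> sets borel \<Longrightarrow> B \<subseteq> G' \<Longrightarrow> \<Gamma> f f B \<le> measure m B"
      using subunit_localize[OF u(1) G'(1)] by metis
    let ?w = "\<lambda>x. min (u x) (T * \<phi> x)"
    have w_off: "?w x = 0" if "x \<notin> S" for x using S(3)[OF that] u(2)[of x] by simp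
    have u_cont: "continuous_on UNIV u" by (rule subunit_continuous[OF u(1)])
    have "?w = (\<lambda>x. min (max (f x) 0) (T * \<phi> x))"
    proof
      fix x show "?w x = min (max (f x) 0) (T * \<phi> x)"
        using f(2)[of x] u(2)[of x] G'(2) S(3)[of x] by (cases "x \<in> S") auto
    qed
    moreover have "(\<lambda>x. min (max (f x) 0) (T * \<phi> x)) \<in> D"
      by (intro D_min D_max coreD(1)[OF f(1)] coreD(1)[OF T\<phi>] dirichlet_zero[OF dirichlet])
    ultimately have "?w \<in> D" by simp
    then have w: "?w \<in> core"
      using w_off by (intro coreI[OF _ _ S(1)] continuous_intros u_cont cont_T\<phi>) auto
    have "\<Gamma> ?w ?w B \<le> measure m B" if B: "B \<in> sets borel" "B \<subseteq> G" for B
    proof -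
      have "G \<subseteq> S" using one S(3) by force
      then have BG: "B \<subseteq> G'" using B(2) G'(2) by blast
      have "?w x = f x" if "x \<in> B" for x
      proof -
        have "\<phi> x = 1" "f x = u x" using that B(2) BG one f(2) by auto
        then show ?thesis using u(3)[of x] by simp
      qed
      then show ?thesis using Gamma_eq_on[OF w f(1) B(1)] f(3)[OF B(1) BG] by simp
    qed
    then have wP: "?w \<in> P" using w by (simp add: P_def)
    \<comment> \<open>Bound the energy of \<open>min u (T\<phi>)\<close>: it vanishes off \<open>S\<close>, agrees with the representative \<open>f\<close> of
      \<open>u\<close> on \<open>S \<inter> ?A\<close>, and with \<open>T\<phi>\<close> on \<open>S - ?A\<close>.\<close>
    let ?A = "{x. u x \<le> T * \<phi> x}"
    have A: "?A \<in> sets borel" by (rule sets_borel_Collect_le[OF u_cont cont_T\<phi>])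
    have "\<Gamma> ?w ?w UNIV = \<Gamma> ?w ?w S + \<Gamma> ?w ?w (- S)"
      using Gamma_split[OF coreD(1)[OF w] SB, of UNIV] by (simp add: Compl_eq_Diff_UNIV)
    also have "\<Gamma> ?w ?w (- S) = 0"
      using SB w_off by (intro Gamma_eq_0[OF w]) auto
    also have "\<Gamma> ?w ?w S = \<Gamma> ?w ?w (S \<inter> ?A) + \<Gamma> ?w ?w (S - ?A)"
      by (rule Gamma_split[OF coreD(1)[OF w] A SB])
    also have "\<Gamma> ?w ?w (S \<inter> ?A) = \<Gamma> f f (S \<inter> ?A)"
      using SB A f(2) G'(2) by (intro Gamma_eq_on[OF w f(1)]) auto
    also have "\<Gamma> ?w ?w (S - ?A) = \<Gamma> (\<lambda>x. T * \<phi> x) (\<lambda>x. T * \<phi> x) (S - ?A)"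
      using SB A by (intro Gamma_eq_on[OF w T\<phi>]) auto
    finally have "\<Gamma> ?w ?w UNIV = \<Gamma> f f (S \<inter> ?A) + \<Gamma> (\<lambda>x. T * \<phi> x) (\<lambda>x. T * \<phi> x) (S - ?A)"
      by simp
    moreover have "\<Gamma> f f (S \<inter> ?A) \<le> measure m S"
    proof -
      have "\<Gamma> f f (S \<inter> ?A) \<le> \<Gamma> f f S"
        using SB A by (intro Gamma_mono[OF coreD(1)[OF f(1)]]) auto
      also have "\<dots> \<le> measure m S" by (rule f(3)[OF SB G'(2)])
      finally show ?thesis .
    qed
    moreover have "\<Gamma> (\<lambda>x. T * \<phi> x) (\<lambda>x. T * \<phi> x) (S - ?A) \<le> T\<^sup>2 * \<Gamma> \<phi> \<phi> UNIV"
    proof -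
      have "\<Gamma> (\<lambda>x. T * \<phi> x) (\<lambda>x. T * \<phi> x) (S - ?A) \<le> \<Gamma> (\<lambda>x. T * \<phi> x) (\<lambda>x. T * \<phi> x) UNIV"
        using SB A by (intro Gamma_mono[OF coreD(1)[OF T\<phi>]]) auto
      also have "\<dots> = T\<^sup>2 * \<Gamma> \<phi> \<phi> UNIV"
        by (rule nonneg_form.form_scale[OF Gamma_form coreD(1)[OF \<phi>(1)]]) simp
      finally show ?thesis .
    qed
    ultimately have strong: "\<Gamma> ?w ?w UNIV \<le> measure m S + T\<^sup>2 * \<Gamma> \<phi> \<phi> UNIV"
      by linarith
    have kS: "S \<in> sets k" using radon_measure_sets[OF killing_radon] SB by simp
    have "(\<integral>\<^sup>+ x. ennreal ((?w x)\<^sup>2) \<partial>k) \<le> (\<integral>\<^sup>+ x. ennreal (T\<^sup>2) * indicator S x \<partial>k)"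
    proof (rule nn_integral_mono)
      fix x
      have "0 \<le> ?w x" "?w x \<le> T" using u(2,3)[of x] T\<phi>_bounds[of x] by auto
      then have "(?w x)\<^sup>2 \<le> T\<^sup>2" by (intro power_mono)
      then show "ennreal ((?w x)\<^sup>2) \<le> ennreal (T\<^sup>2) * indicator S x"
        using w_off[of x] by (cases "x \<in> S") (auto simp: ennreal_leI)
    qed
    also have "\<dots> = ennreal (T\<^sup>2) * emeasure k S" using kS by (simp add: nn_integral_cmult_indicator)
    also have "\<dots> = ennreal (T\<^sup>2 * measure k S)"
      using k_compact[OF S(1)] by (simp add: emeasure_eq_ennreal_measure ennreal_mult)
    finally have killed: "(\<integral>\<^sup>+ x. ennreal ((?w x)\<^sup>2) \<partial>k) \<le> ennreal (T\<^sup>2 * measure k S)" .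
    have nn: "0 \<le> measure m S + T\<^sup>2 * \<Gamma> \<phi> \<phi> UNIV"
      using Gamma_nonneg[OF coreD(1)[OF \<phi>(1)], of UNIV] by simp
    have "ennreal (\<E> ?w ?w)
        \<le> ennreal (measure m S + T\<^sup>2 * \<Gamma> \<phi> \<phi> UNIV) + ennreal (T\<^sup>2 * measure k S)"
      unfolding core_energy[OF w] by (intro add_mono ennreal_leI strong killed)
    also have "\<dots> = ennreal C" unfolding C_def using nn by (intro ennreal_plus[symmetric]) auto
    finally have "ennreal (\<E> ?w ?w) \<le> ennreal C" .
    moreover have "0 \<le> C" using nn by (simp add: C_def)
    ultimately have energy_le: "\<E> ?w ?w \<le> C" by (simp only: ennreal_le_iff)
    have "(\<integral>x. (?w x - ?v x)\<^sup>2 \<partial>m) \<le> \<delta>\<^sup>2 * measure m S"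
    proof (rule L2_norm_le_of_compact_support[OF S(1)])
      show "continuous_on UNIV (\<lambda>x. ?w x - ?v x)"
        by (intro continuous_intros u_cont h(1) cont_T\<phi>)
      show "?w x - ?v x = 0" if "x \<notin> S" for x using w_off v_off that by simp
      then show "\<bar>?w x - ?v x\<bar> \<le> \<delta>" for x
        using u(4)[of x] \<delta>(1) by (cases "x \<in> S") (auto simp: min_def)
    qed
    then show ?thesis using wP energy_le \<delta>(2) by (intro bexI[of _ ?w]) auto
  qed
  have vL2: "?v \<in> L2_space m"
    by (rule L2_norm_le_of_compact_support(1)[OF S(1) v_cont v_bound v_off])
  have "?v \<in> D"
    by (rule dirichlet_convex_approximation(1)[OF dirichlet PD _ vL2]) (fact mid, fact app)
  then have v: "?v \<in> core" by (rule coreI[OF _ v_cont S(1) v_off])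
  have limit: "\<exists>w\<in>P. \<E> (\<lambda>x. w x - ?v x) (\<lambda>x. w x - ?v x) < \<epsilon>" if "0 < \<epsilon>" for \<epsilon>
    by (rule dirichlet_convex_approximation(2)[OF dirichlet PD _ vL2]) (fact mid, fact app, fact that)
  have "\<Gamma> ?v ?v B \<le> measure m B" if B: "B \<in> sets borel" "B \<subseteq> G" for B
  proof (rule nonneg_form.form_le_of_approx[OF Gamma_form[OF B(1)] coreD(1)[OF v]])
    fix \<epsilon> :: real assume "0 < \<epsilon>"
    from limit[OF this]
    obtain w where w: "w \<in> P" "\<E> (\<lambda>x. w x - ?v x) (\<lambda>x. w x - ?v x) < \<epsilon>" by blast
    then have "w \<in> core" by (simp add: P_def)
    from Gamma_le_energy[OF core_diff[OF this v] B(1)] w B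
    show "\<exists>w\<in>D. \<Gamma> w w B \<le> measure m B \<and> \<Gamma> (\<lambda>x. w x - ?v x) (\<lambda>x. w x - ?v x) B < \<epsilon>"
      by (intro bexI[of _ w]) (auto simp: P_def)
  qed
  moreover have "?v x = h x" if "x \<in> G" for x using one[OF that] h(3)[of x] by simp
  ultimately show "\<exists>v\<in>core. (\<forall>x\<in>G. v x = h x) \<and>
      (\<forall>B\<in>sets borel. B \<subseteq> G \<longrightarrow> \<Gamma> v v B \<le> measure m B)"
    by (intro bexI[OF _ v]) auto
qed


section \<open>The energy measure on the local space\<close>

text \<open>
  Decompose the space into countably many disjoint relatively compact pieces.
\<close>

lemma emeasure_le_of_local:
  assumes N: "sets N = sets borel" and M: "sets M = sets borel"
    and le: "\<And>G B. relatively_compact_open G \<Longrightarrow> B \<in> sets borel \<Longrightarrow> B \<subseteq> G \<Longrightarrow> emeasure N B \<le> emeasure M B"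
    and B: "(B::'a set) \<in> sets borel"
  shows "emeasure N B \<le> emeasure M B"
proof -
  obtain G :: "nat \<Rightarrow> 'a set" where G: "\<And>n. relatively_compact_open (G n)" "(\<Union>n. G n) = UNIV"
    using relatively_compact_exhaustion[OF locally_compact] by metis
  define A where "A n = B \<inter> disjointed G n" for n
  have "range G \<subseteq> sets borel" using G(1) by (auto simp: relatively_compact_open_def)
  then have "range (disjointed G) \<subseteq> sets borel" by (rule sets.range_disjointed_sets)
  then have A: "A n \<in> sets borel" for n using B by (auto simp: A_def)
  have disj: "disjoint_family A"
    using disjoint_family_disjointed[of G] by (auto simp: A_def disjoint_family_on_def)
  have un: "(\<Union>n. A n) = B" using UN_disjointed_eq[of G] G(2) by (auto simp: A_def)
  have "A n \<subseteq> G n" for n using disjointed_subset[of G n] by (auto simp: A_def)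
  then have "emeasure N (A n) \<le> emeasure M (A n)" for n by (rule le[OF G(1) A])
  then have "(\<Sum>n. emeasure N (A n)) \<le> (\<Sum>n. emeasure M (A n))" by (intro suminf_le) auto
  moreover have "(\<Sum>n. emeasure N (A n)) = emeasure N B" "(\<Sum>n. emeasure M (A n)) = emeasure M B"
    using suminf_emeasure[of A N] suminf_emeasure[of A M] A disj un N M by auto
  ultimately show ?thesis by simp
qed

text \<open>
  The property by which \<open>mu_c\<close> selects its value.
\<close>

definition represents_energy :: "('a \<Rightarrow> real) \<Rightarrow> 'a measure \<Rightarrow> bool" where
  "represents_energy u \<nu> \<longleftrightarrow> sets \<nu> = sets borel \<and>
     (\<forall>G. \<forall>v\<in>D. relatively_compact_open G \<and> eq_ae_on m G u v \<longrightarrow>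
        (\<forall>B\<in>sets borel. B \<subseteq> G \<longrightarrow> emeasure \<nu> B = ennreal (\<Gamma> v v B)))"

lemma represents_energy_emeasure:
  "represents_energy u \<nu> \<Longrightarrow> v \<in> D \<Longrightarrow> relatively_compact_open G \<Longrightarrow> eq_ae_on m G u v \<Longrightarrow>
    B \<in> sets borel \<Longrightarrow> B \<subseteq> G \<Longrightarrow> emeasure \<nu> B = ennreal (\<Gamma> v v B)"
  unfolding represents_energy_def by blast

lemma D_loc_localize:
  assumes "u \<in> D_loc m D" "relatively_compact_open G"
  shows "\<exists>v\<in>D. eq_ae_on m G u v"
  using assms by (simp add: D_loc_def)

lemma represents_energy_unique:
  assumes u: "u \<in> D_loc m D" and "represents_energy u \<nu>" "represents_energy u \<nu>'"
  shows "\<nu> = \<nu>'"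
proof (rule measure_eqI)
  have s: "sets \<nu> = sets borel" "sets \<nu>' = sets borel"
    using assms by (auto simp: represents_energy_def)
  then show "sets \<nu> = sets \<nu>'" by simp
  have eq: "emeasure \<nu> B = emeasure \<nu>' B"
    if G: "relatively_compact_open G" and B: "B \<in> sets borel" "B \<subseteq> G" for G B
  proof -
    obtain v where v: "v \<in> D" "eq_ae_on m G u v" using D_loc_localize[OF u G] by blast
    show ?thesis
      using represents_energy_emeasure[OF assms(2) v(1) G v(2) B]
        represents_energy_emeasure[OF assms(3) v(1) G v(2) B] by simp
  qed
  fix B assume "B \<in> sets \<nu>"
  then have B: "B \<in> sets borel" using s by simp
  show "emeasure \<nu> B = emeasure \<nu>' B"
    by (intro antisym emeasure_le_of_local[OF s(1) s(2) _ B] emeasure_le_of_local[OF s(2) s(1) _ B])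
      (simp_all add: eq)
qed

text \<open>
  Glue the energy measures of local representatives along a countable partition of the space into
  relatively compact pieces.  Locality makes the result independent of the representatives.
\<close>

lemma ex_represents_energy:
  assumes u: "u \<in> D_loc m D"
  shows "\<exists>\<nu>. represents_energy u \<nu>"
proof -
  obtain G :: "nat \<Rightarrow> 'a set" where G: "\<And>n. relatively_compact_open (G n)" "(\<Union>n. G n) = UNIV"
    using relatively_compact_exhaustion[OF locally_compact] by metis
  obtain v where v: "\<And>n. v n \<in> D" "\<And>n. eq_ae_on m (G n) u (v n)"
    using D_loc_localize[OF u G(1)] by metis
  have "\<exists>M. sets M = sets borel \<and> (\<forall>B\<in>sets borel. emeasure M B = ennreal (\<Gamma> (v n) (v n) B))" for n
    using Gamma_measure[OF v(1)[of n]] by metis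
  then obtain M where M: "\<And>n. sets (M n) = sets borel"
    "\<And>n B. B \<in> sets borel \<Longrightarrow> emeasure (M n) B = ennreal (\<Gamma> (v n) (v n) B)"
    by metis
  define A where "A = disjointed G"
  have "range G \<subseteq> sets borel" using G(1) by (auto simp: relatively_compact_open_def)
  then have "range A \<subseteq> sets borel" unfolding A_def by (rule sets.range_disjointed_sets)
  then have A: "A n \<in> sets borel" for n by auto
  have disj: "disjoint_family A" unfolding A_def by (rule disjoint_family_disjointed)
  have un: "(\<Union>n. A n) = UNIV" using UN_disjointed_eq[of G] G(2) by (simp add: A_def)
  have sub: "A n \<subseteq> G n" for n using disjointed_subset[of G n] by (simp add: A_def)
  define f where "f B = (\<Sum>n. emeasure (M n) (B \<inter> A n))" for B
  define \<nu> where "\<nu> = measure_of UNIV (sets borel) f"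
  have s\<nu>: "sets \<nu> = sets borel"
    unfolding \<nu>_def by (metis sets.sets_measure_of_eq space_borel)
  have em: "emeasure \<nu> B = f B" if B: "B \<in> sets borel" for B
    unfolding \<nu>_def
  proof (rule emeasure_measure_of_sigma[OF _ _ _ B])
    show "sigma_algebra UNIV (sets (borel::'a measure))"
      using sets.sigma_algebra_axioms[of "borel::'a measure"] by simp
    show "positive (sets borel) f" by (simp add: positive_def f_def)
    show "countably_additive (sets borel) f"
      unfolding countably_additive_def
    proof (intro allI impI)
      fix X :: "nat \<Rightarrow> 'a set"
      assume X: "range X \<subseteq> sets borel" "disjoint_family X" "\<Union> (range X) \<in> sets borel"
      have pieces: "(\<Sum>i. emeasure (M n) (X i \<inter> A n)) = emeasure (M n) (\<Union> (range X) \<inter> A n)" for n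
      proof -
        have "(\<Sum>i. emeasure (M n) (X i \<inter> A n)) = emeasure (M n) (\<Union>i. X i \<inter> A n)"
          using X(1,2) A M(1)
          by (intro suminf_emeasure) (auto simp: disjoint_family_on_def)
        moreover have "(\<Union>i. X i \<inter> A n) = \<Union> (range X) \<inter> A n" by blast
        ultimately show ?thesis by simp
      qed
      have "(\<Sum>i. f (X i)) = (\<Sum>n. \<Sum>i. emeasure (M n) (X i \<inter> A n))"
        unfolding f_def by (rule suminf_suminf_commute_ennreal)
      also have "\<dots> = f (\<Union> (range X))"
        unfolding f_def pieces ..
      finally show "(\<Sum>i. f (X i)) = f (\<Union> (range X))" .
    qed
  qed
  have "emeasure \<nu> B = ennreal (\<Gamma> w w B)"
    if w: "w \<in> D" and H: "relatively_compact_open H" "eq_ae_on m H u w"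
      and B: "B \<in> sets borel" "B \<subseteq> H" for H w B
  proof -
    obtain M' where M': "sets M' = sets borel" 
      "\<And>B. B \<in> sets borel \<Longrightarrow> emeasure M' B = ennreal (\<Gamma> w w B)"
      using Gamma_measure[OF w] by metis
    have "emeasure (M n) (B \<inter> A n) = emeasure M' (B \<inter> A n)" for n
    proof -
      have rc: "relatively_compact_open (H \<inter> G n)"
        using relatively_compact_open_subset[OF H(1), of "H \<inter> G n"] H(1) G(1)
        by (simp add: relatively_compact_open_def open_Int)
      have ae: "eq_ae_on m (H \<inter> G n) (v n) w"
        using v(2)[of n] H(2) unfolding eq_ae_on_def by eventually_elim auto
      have BA: "B \<inter> A n \<in> sets borel" using B A by blast
      have "B \<inter> A n \<subseteq> H \<inter> G n" using B(2) sub[of n] by blast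
      then show ?thesis
        using Gamma_local[OF v(1) w rc ae BA] M(2)[OF BA] M'(2)[OF BA] by simp
    qed
    then have "f B = (\<Sum>n. emeasure M' (B \<inter> A n))" by (simp add: f_def)
    also have "\<dots> = emeasure M' (\<Union>n. B \<inter> A n)"
    proof (rule suminf_emeasure)
      show "range (\<lambda>n. B \<inter> A n) \<subseteq> sets M'" using B(1) A M'(1) by auto
      show "disjoint_family (\<lambda>n. B \<inter> A n)"
        using disj unfolding disjoint_family_on_def by blast
    qed
    also have "(\<Union>n. B \<inter> A n) = B" using un by blast
    finally show ?thesis using em[OF B(1)] M'(2)[OF B(1)] by simp
  qed
  then have "represents_energy u \<nu>" using s\<nu> unfolding represents_energy_def by blast
  then show ?thesis ..
qed

lemma mu_c_represents_energy:
  assumes "u \<in> D_loc m D"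
  shows "represents_energy u (mu_c m D \<Gamma> u)"
proof -
  have "mu_c m D \<Gamma> u = (THE \<nu>. represents_energy u \<nu>)"
    by (simp add: mu_c_def represents_energy_def)
  moreover have "\<exists>!\<nu>. represents_energy u \<nu>"
    using ex_represents_energy[OF assms] represents_energy_unique[OF assms] by blast
  ultimately show ?thesis using theI'[of "represents_energy u"] by simp
qed

text \<open>
  A local representative in the domain need not be continuous outside the set where it is
  prescribed.  Truncating \<open>u\<close> between \<open>-M\<phi>\<close> and \<open>M\<phi>\<close>, for a cutoff function \<open>\<phi>\<close> and a bound
  \<open>M\<close> for \<open>u\<close> on its support, gives a representative that is.
\<close>

lemma D_loc_continuous_localize:
  assumes u: "u \<in> D_loc m D" "continuous_on UNIV u" and G: "relatively_compact_open G"
  shows "\<exists>v\<in>core. \<forall>x\<in>G. v x = u x"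
proof -
  obtain \<phi> where \<phi>: "\<phi> \<in> core" "\<And>x. 0 \<le> \<phi> x" "\<And>x. x \<in> closure G \<Longrightarrow> \<phi> x = 1"
    using ex_cutoff[of "closure G"] G unfolding relatively_compact_open_def by metis
  obtain S where S: "compact S" "\<And>x. x \<notin> S \<Longrightarrow> \<phi> x = 0"
    using Cc_space_support[of \<phi>] \<phi>(1) by auto
  obtain G' where G': "relatively_compact_open G'" "S \<subseteq> G'"
    using locally_compact_compact_nhd[OF locally_compact S(1)] by blast
  obtain f where f: "f \<in> D" "eq_ae_on m G' u f" using D_loc_localize[OF u(1) G'(1)] by blast
  have "bounded (u ` S)"
    using compact_continuous_image[OF continuous_on_subset[OF u(2)] S(1)] compact_imp_bounded by blast
  then obtain M where M: "\<And>x. x \<in> S \<Longrightarrow> \<bar>u x\<bar> \<le> M" by (auto simp: bounded_iff)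
  let ?v = "\<lambda>x. max (min (u x) (M * \<phi> x)) (- M * \<phi> x)"
  let ?g = "\<lambda>x. max (min (f x) (M * \<phi> x)) (- M * \<phi> x)"
  have cont: "continuous_on UNIV ?v"
    by (intro continuous_intros u(2) coreD(2)[OF \<phi>(1)])
  have "AE x in m. ?g x = ?v x"
    using f(2) unfolding eq_ae_on_def
  proof eventually_elim
    case (elim x)
    show ?case
    proof (cases "x \<in> S")
      case True then show ?thesis using elim G'(2) by auto
    qed (simp add: S(2))
  qed
  moreover have "?g \<in> D"
    by (intro D_max D_min f(1) energy.scale_mem coreD(1)[OF \<phi>(1)])
  ultimately have "?v \<in> D"
    using dirichlet_class_mem[OF dirichlet _ continuous_measurable_m[OF cont]] by blast
  then have v: "?v \<in> core"
    using S by (intro coreI[OF _ cont S(1)]) auto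
  have "?v x = u x" if "x \<in> G" for x
  proof -
    have one: "\<phi> x = 1" using \<phi>(3) that closure_subset by blast
    then have "x \<in> S" using S(2)[of x] by auto
    then show ?thesis using M[of x] one by auto
  qed
  then show ?thesis using v by (intro bexI[OF _ v]) auto
qed

lemma emeasure_m_eq_measure:
  "relatively_compact_open G \<Longrightarrow> B \<subseteq> G \<Longrightarrow> emeasure m B = ennreal (measure m B)"
  using emeasure_m_finite by (simp add: emeasure_eq_ennreal_measure)

lemma subunit_imp_D_loc:
  assumes u: "u \<in> subunit"
  shows "u \<in> D_loc m D"
proof -
  have meas: "u \<in> borel_measurable m"
    by (rule continuous_measurable_m[OF subunit_continuous[OF u]])
  have "set_integrable m K (\<lambda>x. (u x)\<^sup>2)" if K: "compact K" for K
  proof -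
    obtain G where G: "relatively_compact_open G" "K \<subseteq> G"
      using locally_compact_compact_nhd[OF locally_compact K] by blast
    obtain v where v: "v \<in> core" "\<And>x. x \<in> G \<Longrightarrow> v x = u x"
      using subunit_localize[OF u G(1)] by metis
    have "integrable m (\<lambda>x. (v x)\<^sup>2)"
      using dirichlet_L2[OF dirichlet] v(1) by (auto simp: L2_space_def)
    then have "integrable m (\<lambda>x. indicator K x *\<^sub>R (v x)\<^sup>2)"
      using K sets_m by (intro integrable_mult_indicator) (auto simp: borel_compact)
    moreover have "(\<lambda>x. indicator K x *\<^sub>R (v x)\<^sup>2) = (\<lambda>x. indicator K x *\<^sub>R (u x)\<^sup>2)"
    proof
      fix x show "indicator K x *\<^sub>R (v x)\<^sup>2 = indicator K x *\<^sub>R (u x)\<^sup>2"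
        using v(2)[of x] G(2) by (cases "x \<in> K") auto
    qed
    ultimately show ?thesis by (simp add: set_integrable_def)
  qed
  moreover have "\<exists>v\<in>D. eq_ae_on m G u v" if G: "relatively_compact_open G" for G
  proof -
    obtain v where v: "v \<in> core" "\<And>x. x \<in> G \<Longrightarrow> v x = u x"
      using subunit_localize[OF u G] by metis
    have "eq_ae_on m G u v" using v(2) by (simp add: eq_ae_on_def)
    then show ?thesis using v(1) by blast
  qed
  ultimately show ?thesis using meas by (simp add: D_loc_def L2_loc_def)
qed

lemma mu_c_subunit_le:
  assumes u: "u \<in> subunit" and B: "B \<in> sets borel"
  shows "emeasure (mu_c m D \<Gamma> u) B \<le> emeasure m B"
proof (rule emeasure_le_of_local[OF _ sets_m _ B])
  note rep = mu_c_represents_energy[OF subunit_imp_D_loc[OF u]]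
  then show "sets (mu_c m D \<Gamma> u) = sets borel" by (simp add: represents_energy_def)
  fix G B :: "'a set" assume G: "relatively_compact_open G" and B: "B \<in> sets borel" "B \<subseteq> G"
  obtain v where v: "v \<in> core" "\<And>x. x \<in> G \<Longrightarrow> v x = u x"
    "\<And>B. B \<in> sets borel \<Longrightarrow> B \<subseteq> G \<Longrightarrow> \<Gamma> v v B \<le> measure m B"
    using subunit_localize[OF u G] by metis
  have "eq_ae_on m G u v" using v(2) by (simp add: eq_ae_on_def)
  from represents_energy_emeasure[OF rep coreD(1)[OF v(1)] G this B]
  show "emeasure (mu_c m D \<Gamma> u) B \<le> emeasure m B"
    using v(3)[OF B] emeasure_m_eq_measure[OF G B(2)] by (simp add: ennreal_leI)
qed

lemma subunit_iff_mu_c_le: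
  "subunit = {u \<in> D_loc m D \<inter> C_space.
     \<forall>B\<in>sets borel. emeasure (mu_c m D \<Gamma> u) B \<le> emeasure m B}"
proof (intro equalityI subsetI)
  fix u assume "u \<in> subunit"
  then show "u \<in> {u \<in> D_loc m D \<inter> C_space.
     \<forall>B\<in>sets borel. emeasure (mu_c m D \<Gamma> u) B \<le> emeasure m B}"
    using subunit_imp_D_loc mu_c_subunit_le subunit_continuous by (simp add: C_space_def)
next
  fix u assume "u \<in> {u \<in> D_loc m D \<inter> C_space.
     \<forall>B\<in>sets borel. emeasure (mu_c m D \<Gamma> u) B \<le> emeasure m B}"
  then have u: "u \<in> D_loc m D" "continuous_on UNIV u"
    and le: "\<And>B. B \<in> sets borel \<Longrightarrow> emeasure (mu_c m D \<Gamma> u) B \<le> emeasure m B"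
    by (simp_all add: C_space_def)
  show "u \<in> subunit"
  proof (rule subunitI[OF u(2)])
    fix G :: "'a set" assume G: "relatively_compact_open G"
    obtain v where v: "v \<in> core" "\<And>x. x \<in> G \<Longrightarrow> v x = u x"
      using D_loc_continuous_localize[OF u G] by blast
    have ae: "eq_ae_on m G u v" using v(2) by (simp add: eq_ae_on_def)
    have "\<Gamma> v v B \<le> measure m B" if B: "B \<in> sets borel" "B \<subseteq> G" for B
      using represents_energy_emeasure[OF mu_c_represents_energy[OF u(1)] coreD(1)[OF v(1)] G ae B]
        le[OF B(1)] emeasure_m_eq_measure[OF G B(2)] by simp
    then show "\<exists>v\<in>core. (\<forall>x\<in>G. v x = u x) \<and>
        (\<forall>B\<in>sets borel. B \<subseteq> G \<longrightarrow> \<Gamma> v v B \<le> measure m B)"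
      using v(2) by (intro bexI[OF _ v(1)]) auto
  qed
qed

end


section \<open>The energy distance\<close>

lemma ennreal_plus_le: "ennreal (a + b) \<le> ennreal a + ennreal b"
proof -
  have "ennreal (a + b) \<le> ennreal (max 0 a + max 0 b)" by (intro ennreal_leI) auto
  also have "\<dots> = ennreal (max 0 a) + ennreal (max 0 b)" by (intro ennreal_plus) auto
  also have "\<dots> = ennreal a + ennreal b" by (auto simp: max_def ennreal_neg)
  finally show ?thesis .
qed

lemma ennreal_enn2real_min: "ennreal (enn2real (min c (ennreal T))) = min c (ennreal T)"
  by (intro ennreal_enn2real) (simp add: min_less_iff_disj)

lemma radon_measure_null: "radon_measure (null_measure borel)"
  by (auto simp: radon_measure_on_def sets_restrict_space intro!: antisym SUP_least)

context local_dirichlet_form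
begin

abbreviation \<rho> :: "'a \<Rightarrow> 'a \<Rightarrow> ennreal" where "\<rho> \<equiv> energy_dist m D \<Gamma>"

lemma energy_dist_subunit: "\<rho> x y = (SUP u\<in>subunit. ennreal (u x - u y))"
  by (simp only: energy_dist_def subunit_iff_mu_c_le)

lemma subunit_diff_le: "u \<in> subunit \<Longrightarrow> ennreal (u x - u y) \<le> \<rho> x y"
  unfolding energy_dist_subunit by (rule SUP_upper)

lemma energy_dist_commute_le: "\<rho> x y \<le> \<rho> y x"
  unfolding energy_dist_subunit[of x y]
proof (rule SUP_least)
  fix u assume "u \<in> subunit"
  from subunit_diff_le[OF subunit_uminus[OF this], of y x]
  show "ennreal (u x - u y) \<le> \<rho> y x" by simp
qed

lemma energy_dist_refl: "\<rho> x x = 0"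
proof -
  have "\<rho> x x \<le> 0" unfolding energy_dist_subunit by (rule SUP_least) simp
  then show ?thesis by simp
qed

lemma pseudo_metric_energy_dist: "pseudo_metric \<rho>"
  unfolding pseudo_metric_def
proof (intro conjI allI)
  show "\<rho> x x = 0" for x by (rule energy_dist_refl)
  show "\<rho> x y = \<rho> y x" for x y by (intro antisym energy_dist_commute_le)
  show "\<rho> x z \<le> \<rho> x y + \<rho> y z" for x y z
    unfolding energy_dist_subunit[of x z]
  proof (rule SUP_least)
    fix u assume u: "u \<in> subunit"
    have "ennreal (u x - u z) \<le> ennreal (u x - u y) + ennreal (u y - u z)"
      using ennreal_plus_le[of "u x - u y" "u y - u z"] by simp
    also have "\<dots> \<le> \<rho> x y + \<rho> y z" by (intro add_mono subunit_diff_le u)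
    finally show "ennreal (u x - u z) \<le> \<rho> x y + \<rho> y z" .
  qed
qed

end

locale continuous_energy_dist = local_dirichlet_form +
  assumes continuous_dist: "continuous_on UNIV (\<lambda>(x, y). energy_dist m D \<Gamma> x y)"
begin

lemma energy_ball:
  assumes "0 < e"
  shows "open {y. \<rho> x y < ennreal e}" "x \<in> {y. \<rho> x y < ennreal e}"
proof -
  have "continuous_on UNIV (\<lambda>y. (\<lambda>(x, y). \<rho> x y) (x, y))"
    by (rule continuous_on_compose2[OF continuous_dist]) (auto intro: continuous_intros)
  then show "open {y. \<rho> x y < ennreal e}"
    by (intro open_Collect_less) auto
  show "x \<in> {y. \<rho> x y < ennreal e}" using assms by (simp add: energy_dist_refl)
qed

lemma continuous_if_Lipschitz:
  fixes f :: "'a \<Rightarrow> real"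
  assumes lip: "\<And>x y. ennreal (f x - f y) \<le> \<rho> x y"
  shows "continuous_on UNIV f"
proof (rule continuous_at_imp_continuous_on, rule ballI)
  fix x
  show "isCont f x"
    unfolding isCont_def
  proof (rule tendstoI)
    fix e :: real assume e: "0 < e"
    have close: "dist (f y) (f x) < e" if "\<rho> x y < ennreal e" for y
    proof -
      have "ennreal (f x - f y) < ennreal e" "ennreal (f y - f x) < ennreal e"
        using lip[of x y] lip[of y x] energy_dist_commute_le[of y x] that by auto
      then have "f x - f y < e" "f y - f x < e"
        using e by (auto simp: ennreal_less_iff intro: ccontr)
      then show ?thesis by (simp add: dist_real_def abs_less_iff)
    qed
    have "\<forall>\<^sub>F y in nhds x. y \<in> {y. \<rho> x y < ennreal e}"
      using energy_ball[OF e, of x] by (intro eventually_nhds_in_open) auto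
    then show "\<forall>\<^sub>F y in at x. dist (f y) (f x) < e"
      unfolding at_within_def by (intro filter_leD[OF inf_le1]) (auto elim: eventually_mono intro: close)
  qed
qed

text \<open>
  The supremum \<open>h\<close> inherits the Lipschitz bound by \<open>\<rho>\<close> and is continuous.  For a compact \<open>K\<close>
  choose at each \<open>z\<close> a function \<open>f z\<close> that almost attains \<open>h z\<close>.  It is almost as large as \<open>h\<close> on a
  whole \<open>\<rho>\<close>-ball around \<open>z\<close>, and \<open>\<rho>\<close>-balls are open.  Finitely many of them cover \<open>K\<close>, so a
  finite maximum is uniformly close to \<open>h\<close> on \<open>K\<close>.
\<close>

lemma subunit_pointwise_sup:
  assumes S: "S \<subseteq> subunit" and pos: "\<And>f x. f \<in> S \<Longrightarrow> 0 \<le> f x"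
    and upper: "\<And>f x. f \<in> S \<Longrightarrow> f x \<le> h x" and bound: "\<And>x. h x \<le> T"
    and least: "\<And>x \<epsilon>. 0 < \<epsilon> \<Longrightarrow> \<exists>f\<in>S. h x - \<epsilon> < f x"
  shows "h \<in> subunit"
proof -
  have h0: "0 \<le> h x" for x
    using least[of 1 x] pos upper order_trans by (metis zero_less_one)
  have "ennreal (h x - h y) \<le> \<rho> x y" for x y
  proof (rule ennreal_le_epsilon)
    fix e :: real assume "0 < e"
    then obtain f where f: "f \<in> S" "h x - e < f x" using least by blast
    have "ennreal (h x - h y) \<le> ennreal ((f x - f y) + e)"
      using f upper[OF f(1), of y] by (intro ennreal_leI) simp
    also have "\<dots> \<le> ennreal (f x - f y) + ennreal e" by (rule ennreal_plus_le)
    also have "\<dots> \<le> \<rho> x y + ennreal e" using f S by (intro add_mono subunit_diff_le) auto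
    finally show "ennreal (h x - h y) \<le> \<rho> x y + ennreal e" .
  qed
  then have cont: "continuous_on UNIV h" by (rule continuous_if_Lipschitz)
  have finite_max: "\<exists>u\<in>subunit. (\<forall>x. 0 \<le> u x \<and> u x \<le> h x) \<and> (\<forall>f\<in>F. \<forall>x. f x \<le> u x)"
    if "finite F" "F \<subseteq> S" for F
    using that
  proof (induction F rule: finite_induct)
    case empty
    show ?case using h0 by (intro bexI[OF _ subunit_const[of 0]]) simp
  next
    case (insert f F)
    then obtain u where u: "u \<in> subunit" "\<And>x. 0 \<le> u x \<and> u x \<le> h x" "\<And>f x. f \<in> F \<Longrightarrow> f x \<le> u x"
      by auto
    have f: "f \<in> S" using insert.prems by simp
    show ?case
    proof (intro bexI[OF _ subunit_max[OF u(1)]] conjI ballI allI)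
      show "f \<in> subunit" using f S by blast
      show "0 \<le> max (u x) (f x)" "max (u x) (f x) \<le> h x" for x
        using u(2)[of x] upper[OF f, of x] by auto
      show "g x \<le> max (u x) (f x)" if "g \<in> insert f F" for g x
        using that u(3)[of g x] by auto
    qed
  qed
  show ?thesis
  proof (rule subunit_locally_uniform_limit[OF cont h0 bound])
    fix K :: "'a set" and \<epsilon> :: real assume K: "compact K" and \<epsilon>: "0 < \<epsilon>"
    \<comment> \<open>One \<open>e\<close> for \<open>f z\<close> against \<open>h\<close> at \<open>z\<close>, one for \<open>f z\<close> between \<open>z\<close> and \<open>x\<close>, and two for \<open>h\<close> between
      \<open>x\<close> and \<open>z\<close>, where \<open>h x\<close> is compared through a function \<open>g\<close> that almost attains it.\<close>
    define e where "e = \<epsilon> / 4"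
    have e: "0 < e" using \<epsilon> by (simp add: e_def)
    obtain f where f: "\<And>z. f z \<in> S" "\<And>z. h z - e < f z z"
      using least[OF e] by metis
    have op: "open {y. \<rho> z y < ennreal e}" for z by (rule energy_ball(1)[OF e])
    have cov: "K \<subseteq> (\<Union>z\<in>K. {y. \<rho> z y < ennreal e})" using energy_ball(2)[OF e] by auto
    obtain Z where Z: "Z \<subseteq> K" "finite Z" "K \<subseteq> (\<Union>z\<in>Z. {y. \<rho> z y < ennreal e})"
      using compactE_image[OF K op cov] by metis
    obtain u where u: "u \<in> subunit" "\<And>x. 0 \<le> u x \<and> u x \<le> h x" "\<And>z x. z \<in> Z \<Longrightarrow> f z x \<le> u x"
    proof -
      have "f ` Z \<subseteq> S" using f(1) by blast
      from finite_max[OF finite_imageI[OF Z(2)] this] show thesis using that by (metis imageI)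
    qed
    have "\<bar>u x - h x\<bar> \<le> \<epsilon>" if xK: "x \<in> K" for x
    proof -
      obtain z where z: "z \<in> Z" "\<rho> z x < ennreal e" using Z(3) xK by blast
      have lip: "g \<in> subunit \<Longrightarrow> g p - g q < e" if "\<rho> p q < ennreal e" for g p q
        using subunit_diff_le[of g p q] that e
        by (meson ennreal_leI le_less_trans not_less)
      have xz: "\<rho> x z < ennreal e" using z(2) energy_dist_commute_le[of x z] by auto
      obtain g where g: "g \<in> S" "h x - e < g x" using least[OF e] by blast
      have "f z z - f z x < e" using lip[OF z(2)] f(1) S by blast
      moreover have "g x - g z < e" using lip[OF xz] g(1) S by blast
      moreover have "g z \<le> h z" by (rule upper[OF g(1)])
      ultimately have "h x - 4 * e < u x"
        using f(2)[of z] g(2) u(3)[OF z(1), of x] by linarith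
      then show ?thesis using u(2)[of x] \<epsilon> by (simp add: e_def abs_le_iff)
    qed
    moreover have "0 \<le> u x \<and> u x \<le> T" for x using u(2)[of x] bound[of x] by auto
    ultimately show "\<exists>u\<in>subunit. (\<forall>x. 0 \<le> u x \<and> u x \<le> T) \<and> (\<forall>x\<in>K. \<bar>u x - h x\<bar> \<le> \<epsilon>)"
      using u(1) by blast
  qed
qed

lemma subunit_pointwise_inf:
  assumes S: "S \<subseteq> subunit" and bound: "\<And>f x. f \<in> S \<Longrightarrow> f x \<le> T"
    and lower: "\<And>f x. f \<in> S \<Longrightarrow> h x \<le> f x" and pos: "\<And>x. 0 \<le> h x"
    and greatest: "\<And>x \<epsilon>. 0 < \<epsilon> \<Longrightarrow> \<exists>f\<in>S. f x < h x + \<epsilon>"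
  shows "h \<in> subunit"
proof -
  have flip: "(\<lambda>x. T - f x) \<in> subunit" if "f \<in> subunit" for f
    using subunit_add_const[OF subunit_uminus[OF that], of T] by simp
  have "(\<lambda>x. T - h x) \<in> subunit"
  proof (rule subunit_pointwise_sup[of "(\<lambda>f x. T - f x) ` S" _ T])
    show "(\<lambda>f x. T - f x) ` S \<subseteq> subunit" using S flip by blast
    show "\<exists>g\<in>(\<lambda>f x. T - f x) ` S. T - h x - \<epsilon> < g x" if "0 < \<epsilon>" for x \<epsilon>
      using greatest[OF that, of x] by force
  qed (use bound lower pos in auto)
  from flip[OF this] show ?thesis by simp
qed

lemma trunc_dist_bounds:
  assumes "0 < T"
  shows "0 \<le> trunc_dist \<sigma> A T x" "trunc_dist \<sigma> A T x \<le> T"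
proof -
  show "0 \<le> trunc_dist \<sigma> A T x" by (simp add: trunc_dist_def)
  have "trunc_dist \<sigma> A T x \<le> enn2real (ennreal T)"
    unfolding trunc_dist_def by (rule enn2real_mono) auto
  then show "trunc_dist \<sigma> A T x \<le> T" using assms by simp
qed

text \<open>
  \<open>\<rho>(\<cdot>,y) \<and> T\<close> is the supremum of the truncations of \<open>u - u(y)\<close> to \<open>[0,T]\<close>, over all subunit \<open>u\<close>.
\<close>

lemma trunc_dist_singleton_subunit:
  assumes T: "0 < T"
  shows "trunc_dist \<rho> {y} T \<in> subunit"
proof (rule subunit_pointwise_sup[of "(\<lambda>u x. max 0 (min (u x - u y) T)) ` subunit" _ T])
  let ?t = "trunc_dist \<rho> {y} T"
  have t: "ennreal (?t x) = min (\<rho> x y) (ennreal T)" for x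
    by (simp add: trunc_dist_def ennreal_enn2real_min)
  show "(\<lambda>u x. max 0 (min (u x - u y) T)) ` subunit \<subseteq> subunit"
    using subunit_clamp[OF subunit_add_const] by (auto simp: diff_conv_add_uminus simp del: add_uminus_conv_diff)
  show "?t x \<le> T" for x by (rule trunc_dist_bounds[OF T])
  show "f x \<le> ?t x" if f: "f \<in> (\<lambda>u x. max 0 (min (u x - u y) T)) ` subunit" for f x
  proof -
    obtain u where u: "u \<in> subunit" "f = (\<lambda>x. max 0 (min (u x - u y) T))" using f by blast
    have "ennreal (f x) \<le> ennreal (u x - u y)" "ennreal (f x) \<le> ennreal T"
      using T by (auto simp: u(2) max_def min_def ennreal_neg intro!: ennreal_leI)
    then have "ennreal (f x) \<le> ennreal (?t x)"
      using subunit_diff_le[OF u(1), of x y] unfolding t by auto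
    then show ?thesis by (simp only: ennreal_le_iff[OF trunc_dist_bounds(1)[OF T]])
  qed
  show "\<exists>f\<in>(\<lambda>u x. max 0 (min (u x - u y) T)) ` subunit. ?t x - \<epsilon> < f x" if \<epsilon>: "0 < \<epsilon>" for x \<epsilon>
  proof (cases "?t x - \<epsilon> < 0")
    case True
    then show ?thesis
      by (intro bexI[OF _ imageI[OF subunit_const[of 0]]]) (auto simp: max_def)
  next
    case False
    then have "ennreal (?t x - \<epsilon>) < ennreal (?t x)" using \<epsilon> by (intro ennreal_lessI) auto
    also have "\<dots> \<le> \<rho> x y" unfolding t by simp
    finally obtain u where u: "u \<in> subunit" "ennreal (?t x - \<epsilon>) < ennreal (u x - u y)"
      unfolding energy_dist_subunit less_SUP_iff by blast
    then have "?t x - \<epsilon> < u x - u y" using False by (simp add: ennreal_less_iff)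
    moreover have "?t x - \<epsilon> < T" using trunc_dist_bounds(2)[OF T, of \<rho> "{y}" x] \<epsilon> by simp
    ultimately show ?thesis by (intro bexI[OF _ imageI[OF u(1)]]) auto
  qed
qed auto

text \<open>
  \<open>\<rho>\<^sub>A \<and> T\<close> is the infimum of \<open>\<rho>(\<cdot>,y) \<and> T\<close> over \<open>y \<in> A\<close>, and the constant \<open>T\<close> if \<open>A\<close> is empty.
\<close>

lemma trunc_dist_subunit:
  assumes T: "0 < T"
  shows "trunc_dist \<rho> A T \<in> subunit"
proof (cases "A = {}")
  case True
  then have "trunc_dist \<rho> A T = (\<lambda>_. T)" using T by (auto simp: trunc_dist_def)
  then show ?thesis using subunit_const by simp
next
  case False
  let ?t = "trunc_dist \<rho> A T"
  have t: "ennreal (?t x) = min (INF y\<in>A. \<rho> x y) (ennreal T)" for x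
    by (simp add: trunc_dist_def ennreal_enn2real_min)
  have t1: "ennreal (trunc_dist \<rho> {y} T x) = min (\<rho> x y) (ennreal T)" for x y
    by (simp add: trunc_dist_def ennreal_enn2real_min)
  show ?thesis
  proof (rule subunit_pointwise_inf[of "(\<lambda>y. trunc_dist \<rho> {y} T) ` A" T])
    show "(\<lambda>y. trunc_dist \<rho> {y} T) ` A \<subseteq> subunit"
      using trunc_dist_singleton_subunit[OF T] by blast
    show "f x \<le> T" if "f \<in> (\<lambda>y. trunc_dist \<rho> {y} T) ` A" for f x
      using that trunc_dist_bounds(2)[OF T] by auto
    show "0 \<le> ?t x" for x by (rule trunc_dist_bounds(1)[OF T])
    show "?t x \<le> f x" if f: "f \<in> (\<lambda>y. trunc_dist \<rho> {y} T) ` A" for f x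
    proof -
      obtain y where y: "y \<in> A" "f = trunc_dist \<rho> {y} T" using f by blast
      have "ennreal (?t x) \<le> ennreal (f x)"
        unfolding t y(2) t1 by (intro min.mono INF_lower y(1) order_refl)
      then show ?thesis
        unfolding y(2) by (simp only: ennreal_le_iff[OF trunc_dist_bounds(1)[OF T]])
    qed
    show "\<exists>f\<in>(\<lambda>y. trunc_dist \<rho> {y} T) ` A. f x < ?t x + \<epsilon>" if \<epsilon>: "0 < \<epsilon>" for x \<epsilon>
    proof (rule ccontr)
      assume "\<not> ?thesis"
      then have far: "?t x + \<epsilon> \<le> trunc_dist \<rho> {y} T x" if "y \<in> A" for y
        using that by (force simp: not_less)
      have "ennreal (?t x + \<epsilon>) \<le> min (\<rho> x y) (ennreal T)" if "y \<in> A" for y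
        using ennreal_leI[OF far[OF that]] unfolding t1 .
      then have "ennreal (?t x + \<epsilon>) \<le> min (INF y\<in>A. \<rho> x y) (ennreal T)"
        using False by (auto intro: INF_greatest)
      then have "ennreal (?t x + \<epsilon>) \<le> ennreal (?t x)" unfolding t .
      then show False
        using \<epsilon> trunc_dist_bounds(1)[OF T, of \<rho> A x] by (simp add: ennreal_le_iff)
    qed
  qed
qed

lemma mu_b_eq_0: "mu_b m D \<E> J u B = 0"
proof -
  have "mu_b m D \<E> J u B = (\<integral>\<^sup>+ z. 0 \<partial>J)"
    unfolding mu_b_def by (rule nn_integral_cong_AE[OF AE_no_jumps])
  then show ?thesis by simp
qed

text \<open>
  Without jumps the whole mass \<open>m\<close> is available for the strongly local part: take
  \<open>m\<^sub>b = 0\<close> and \<open>m\<^sub>c = m\<close>.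
\<close>

lemma intrinsic_energy_dist: "intrinsic_metric m D \<E> J \<Gamma> \<rho>"
proof -
  have "trunc_dist \<rho> A T \<in> D_loc_star m D \<E> J \<inter> C_space \<and>
      (\<forall>B\<in>sets borel. mu_b m D \<E> J (trunc_dist \<rho> A T) B \<le> emeasure (null_measure borel) B) \<and>
      (\<forall>B\<in>sets borel. emeasure (mu_c m D \<Gamma> (trunc_dist \<rho> A T)) B \<le> emeasure m B)"
    if "0 < T" for A T
    using trunc_dist_subunit[OF that, of A] unfolding subunit_iff_mu_c_le
    by (simp add: D_loc_star_def mu_b_eq_0)
  then show ?thesis
    unfolding intrinsic_metric_def
    by (intro conjI pseudo_metric_energy_dist exI[of _ "null_measure borel"] exI[of _ m]
        radon_measure_null radon) auto
qed

end

context local_dirichlet_form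
begin

text \<open>
  The truncated \<open>\<sigma>\<close>-distance from \<open>y\<close> is one of the functions over which the supremum \<open>\<rho> x y\<close>
  is taken.
\<close>

lemma intrinsic_metric_le_energy_dist:
  assumes \<sigma>: "intrinsic_metric m D \<E> J \<Gamma> \<sigma>"
  shows "\<sigma> x y \<le> \<rho> x y"
proof -
  obtain m\<^sub>b m\<^sub>c where mm: "\<And>B. B \<in> sets borel \<Longrightarrow> emeasure m\<^sub>b B + emeasure m\<^sub>c B \<le> emeasure m B"
    and tr: "\<And>A T. 0 < T \<Longrightarrow> trunc_dist \<sigma> A T \<in> D_loc_star m D \<E> J \<inter> C_space"
    and mu: "\<And>A T B. 0 < T \<Longrightarrow> B \<in> sets borel \<Longrightarrow>
      emeasure (mu_c m D \<Gamma> (trunc_dist \<sigma> A T)) B \<le> emeasure m\<^sub>c B"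
    using \<sigma> unfolding intrinsic_metric_def by metis
  have refl: "\<sigma> y y = 0" using \<sigma> by (simp add: intrinsic_metric_def pseudo_metric_def)
  have trunc: "min (\<sigma> x y) (ennreal T) \<le> \<rho> x y" if T: "0 < T" for T
  proof -
    have "emeasure (mu_c m D \<Gamma> (trunc_dist \<sigma> {y} T)) B \<le> emeasure m B"
      if B: "B \<in> sets borel" for B
    proof -
      have "emeasure (mu_c m D \<Gamma> (trunc_dist \<sigma> {y} T)) B \<le> emeasure m\<^sub>c B"
        by (rule mu[OF T B])
      also have "\<dots> \<le> emeasure m\<^sub>b B + emeasure m\<^sub>c B" by simp
      also have "\<dots> \<le> emeasure m B" by (rule mm[OF B])
      finally show ?thesis .
    qed
    then have "trunc_dist \<sigma> {y} T \<in> subunit"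
      using tr[OF T, of "{y}"] unfolding subunit_iff_mu_c_le by (simp add: D_loc_star_def)
    from subunit_diff_le[OF this, of x y]
    show ?thesis using refl T by (simp add: trunc_dist_def ennreal_enn2real_min)
  qed
  show ?thesis
  proof (cases "\<rho> x y")
    case (real r)
    show ?thesis
    proof (rule ccontr)
      assume "\<not> \<sigma> x y \<le> \<rho> x y"
      then have "ennreal r < min (\<sigma> x y) (ennreal (r + 1))"
        using real by (auto simp: ennreal_less_iff)
      also have "\<dots> \<le> ennreal r"
        unfolding real(2)[symmetric] by (rule trunc) (use real(1) in simp)
      finally show False by simp
    qed
  qed simp
qed

end

theorem theorem6p3:
  fixes m :: "'a::{metric_space, second_countable_topology} measure"
    and D :: "('a \<Rightarrow> real) set"
    and \<E> :: "('a \<Rightarrow> real) \<Rightarrow> ('a \<Rightarrow> real) \<Rightarrow> real"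
    and J :: "('a \<times> 'a) measure"
    and \<Gamma> :: "('a \<Rightarrow> real) \<Rightarrow> ('a \<Rightarrow> real) \<Rightarrow> 'a set \<Rightarrow> real"
    and k :: "'a measure"
  assumes "locally compact (UNIV :: 'a set)"
    and "radon_measure m" and "full_support m"
    and "regular_dirichlet_form m D \<E>"
    and "beurling_deny m D \<E> J \<Gamma> k"
    and local: "\<forall>B\<in>sets J. emeasure J B = 0"
    and cont: "continuous_on UNIV (\<lambda>(x, y). energy_dist m D \<Gamma> x y)"
  shows "intrinsic_metric m D \<E> J \<Gamma> (energy_dist m D \<Gamma>) \<and>
    (\<forall>\<sigma>. intrinsic_metric m D \<E> J \<Gamma> \<sigma> \<longrightarrow> (\<forall>x y. \<sigma> x y \<le> energy_dist m D \<Gamma> x y))"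
proof -
  interpret continuous_energy_dist m D \<E> J \<Gamma> k
    by unfold_locales (fact assms)+
  show ?thesis
    using intrinsic_energy_dist intrinsic_metric_le_energy_dist by blast
qed

end
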